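(* Let $0 \le q < p \le 1$ be constants and let $c := \max\left\{\frac{88}{p-q}, \frac{72}{(p-q)^2}\right\}$. Let $n = ks$ and let $\mathcal C = \{C_1,\dots,C_k\}$ be an (unknown) partition of $[n]$ into $k$ clusters each of size $s$, where $s \ge c\sqrt{n}$. Let $\hat G$ be the adjacency matrix of a random graph drawn from $\mathcal G(n,\mathcal C,p,q)$. Then, for all sufficiently large $n$, with probability $1-o(1)$, the algorithm $\mathrm{IdentifyClusters}(\hat G, s)$ (described in the context) returns exactly the collection $\{C_1,\dots,C_k\}$, i.e., it correctly recovers the planted partition.
   Context: The planted partition model $\mathcal G(n,\mathcal C,p,q)$: given a partition $\mathcal C=\{C_1,\dots,C_k\}$ of $[n]=\{1,\dots,n\}$ into $k$ sets ("clusters") of size $s=n/k$ and constants $0\le q<p\le 1$, a random graph on vertex set $[n]$ is generated by including each edge $ij$ ($i\ne j$) independently with probability $p$ if $i,j$ lie in the same cluster and with probability $q$ otherwise. For a symmetric matrix $A$, $P_l(A)$ denotes the orthogonal projection onto the subspace spanned by eigenvectors corresponding to the $l$ largest eigenvalues of $A$. For $S$ a set of vertices, $\mathbf 1_S$ is its indicator vector. Algorithm $\mathrm{IdentifyClusters}(\hat G, s)$: let $n$ be the number of vertices of $\hat G$ and $k=\lfloor n/s\rfloor$. If $k<1$, return $\emptyset$. Otherwise: let $\hat P = P_k(\hat G)$. For each vertex $j$, let $\hat P_{i_1 j}\ge \dots\ge \hat P_{i_{n-1}j}$ be the entries of column $j$ of $\hat P$ other than $\hat P_{jj}$ (ties broken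 arbitrarily), and set $W_j=\{j,i_1,\dots,i_{s-1}\}$. Let $j^*$ be a vertex maximizing $\|\hat P\mathbf 1_{W_j}\|_2$. Let $C$ be the set of $s$ vertices of $\hat G$ having the most neighbors in $W_{j^*}$. Return $\{C\}\cup \mathrm{IdentifyClusters}(\hat G\setminus C, s)$, where $\hat G\setminus C$ is the induced subgraph on the vertices not in $C$. *)

theory Defs
  imports "HOL-Probability.Probability" "HOL-Library.Disjoint_Sets"
begin

text \<open>
  Vectors and matrices are indexed by a finite vertex set \<open>V\<close>, given as functions of which only
  the values on \<open>V\<close> matter; the vertex set shrinks along the recursion of the algorithm.
\<close>

definition mat_vec_on :: "nat set \<Rightarrow> (nat \<Rightarrow> nat \<Rightarrow> real) \<Rightarrow> (nat \<Rightarrow> real) \<Rightarrow> nat \<Rightarrow> real" where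
  "mat_vec_on V A x i = (\<Sum>j\<in>V. A i j * x j)"

definition inner_on :: "nat set \<Rightarrow> (nat \<Rightarrow> real) \<Rightarrow> (nat \<Rightarrow> real) \<Rightarrow> real" where
  "inner_on V x y = (\<Sum>i\<in>V. x i * y i)"

definition eigenvector_on :: "nat set \<Rightarrow> (nat \<Rightarrow> nat \<Rightarrow> real) \<Rightarrow> (nat \<Rightarrow> real) \<Rightarrow> real \<Rightarrow> bool" where
  "eigenvector_on V A x \<mu> \<longleftrightarrow>
     (\<exists>i\<in>V. x i \<noteq> 0) \<and> (\<forall>i\<in>V. mat_vec_on V A x i = \<mu> * x i)"

text \<open>The eigenvalues are listed in non-increasing order, with multiplicity.\<close>

definition ordered_eigenbasis ::
  "nat set \<Rightarrow> (nat \<Rightarrow> nat \<Rightarrow> real) \<Rightarrow> (nat \<Rightarrow> nat \<Rightarrow> real) \<Rightarrow> (nat \<Rightarrow> real) \<Rightarrow> bool" where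
  "ordered_eigenbasis V A u \<mu> \<longleftrightarrow>
     (\<forall>a<card V. eigenvector_on V A (u a) (\<mu> a)) \<and>
     (\<forall>a<card V. \<forall>b<card V. inner_on V (u a) (u b) = (if a = b then 1 else 0)) \<and>
     (\<forall>a b. a \<le> b \<and> b < card V \<longrightarrow> \<mu> b \<le> \<mu> a)"

definition span_first :: "nat \<Rightarrow> (nat \<Rightarrow> nat \<Rightarrow> real) \<Rightarrow> (nat \<Rightarrow> real) set" where
  "span_first l u = {\<lambda>i. \<Sum>a<l. c a * u a i | c. True}"

definition orthogonal_projection_on ::
  "nat set \<Rightarrow> (nat \<Rightarrow> real) set \<Rightarrow> (nat \<Rightarrow> nat \<Rightarrow> real) \<Rightarrow> bool" where
  "orthogonal_projection_on V S P \<longleftrightarrow>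
     (\<forall>x. (\<exists>y\<in>S. \<forall>i\<in>V. mat_vec_on V P x i = y i) \<and>
          (\<forall>y\<in>S. inner_on V (\<lambda>i. x i - mat_vec_on V P x i) y = 0))"

text \<open>
  \<open>top_projection V A l P\<close>: the matrix \<open>P\<close> is a version of $P_l(A)$. It is unique on \<open>V\<close> unless the
  \<open>l\<close>-th and the next eigenvalue coincide, in which case every choice of eigenvectors is admitted.
\<close>

definition top_projection ::
  "nat set \<Rightarrow> (nat \<Rightarrow> nat \<Rightarrow> real) \<Rightarrow> nat \<Rightarrow> (nat \<Rightarrow> nat \<Rightarrow> real) \<Rightarrow> bool" where
  "top_projection V A l P \<longleftrightarrow>
     (\<exists>u \<mu>. ordered_eigenbasis V A u \<mu> \<and> orthogonal_projection_on V (span_first l u) P)"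

text \<open>Graphs are given by a vertex set \<open>V\<close> and a set \<open>E\<close> of two-element subsets of \<open>V\<close>.\<close>

definition all_edges :: "nat set \<Rightarrow> nat set set" where
  "all_edges V = {e. e \<subseteq> V \<and> card e = 2}"

definition adjacency :: "nat set set \<Rightarrow> nat \<Rightarrow> nat \<Rightarrow> real" where
  "adjacency E i j = (if {i, j} \<in> E then 1 else 0)"

definition num_neighbors_in :: "nat set set \<Rightarrow> nat set \<Rightarrow> nat \<Rightarrow> nat" where
  "num_neighbors_in E W v = card {w \<in> W. {v, w} \<in> E}"

definition induced_edges :: "nat set set \<Rightarrow> nat set \<Rightarrow> nat set set" where
  "induced_edges E U = {e \<in> E. e \<subseteq> U}"

definition planted_partition :: "nat \<Rightarrow> nat set set \<Rightarrow> real \<Rightarrow> real \<Rightarrow> nat set set pmf" where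
  "planted_partition n \<C> p q =
     map_pmf (\<lambda>f. {e \<in> all_edges {1..n}. f e})
       (Pi_pmf (all_edges {1..n}) False
         (\<lambda>e. bernoulli_pmf (if \<exists>C\<in>\<C>. e \<subseteq> C then p else q)))"

text \<open>The list \<open>js\<close> is the ordering $i_1, \dots, i_{n-1}$ of the vertices other than \<open>j\<close>.\<close>

definition top_column_set :: "nat set \<Rightarrow> (nat \<Rightarrow> nat \<Rightarrow> real) \<Rightarrow> nat \<Rightarrow> nat \<Rightarrow> nat set \<Rightarrow> bool" where
  "top_column_set V P s j W \<longleftrightarrow>
     (\<exists>js. distinct js \<and> set js = V - {j} \<and> sorted_wrt (\<lambda>a b. P a j \<ge> P b j) js \<and>
           W = insert j (set (take (s - 1) js)))"

definition most_neighbors :: "nat set \<Rightarrow> nat set set \<Rightarrow> nat \<Rightarrow> nat set \<Rightarrow> nat set \<Rightarrow> bool" where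
  "most_neighbors V E s W C \<longleftrightarrow>
     C \<subseteq> V \<and> card C = s \<and>
     (\<forall>v\<in>C. \<forall>w\<in>V - C. num_neighbors_in E W w \<le> num_neighbors_in E W v)"

text \<open>
  \<open>identify_clusters s V E R\<close>: some run of the algorithm on the graph \<open>(V, E)\<close> returns \<open>R\<close>. The
  algorithm is a relation because ties (in the eigenvalues, the columns, the maximiser \<open>j\<close>, and
  the numbers of neighbours) are broken arbitrarily. Each recursive call removes \<open>s \<ge> 1\<close> vertices,
  so all runs are finite.
\<close>

inductive identify_clusters :: "nat \<Rightarrow> nat set \<Rightarrow> nat set set \<Rightarrow> nat set set \<Rightarrow> bool" for s where
  stop: "card V div s < 1 \<Longrightarrow> identify_clusters s V E {}"
| step: "\<lbrakk>k = card V div s; k \<ge> 1;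
          top_projection V (adjacency E) k P;
          \<forall>j\<in>V. top_column_set V P s j (W j);
          j \<in> V;
          \<forall>i\<in>V. L2_set (mat_vec_on V P (indicator (W i))) V
                  \<le> L2_set (mat_vec_on V P (indicator (W j))) V;
          most_neighbors V E s (W j) C;
          identify_clusters s (V - C) (induced_edges E (V - C)) R\<rbrakk>
         \<Longrightarrow> identify_clusters s V E (insert C R)"

end

theory Submission
  imports Defs "HOL-Real_Asymp.Real_Asymp"
begin

text \<open>
  Write the adjacency matrix as $G - pI + X$, where $G$ is the block matrix of the edge
  probabilities. The shift by $pI$ does not change eigenvectors, $G$ has eigenvalues at least
  $(p-q)s$ on the span of the \<open>k\<close> cluster vectors and vanishes on its complement. Two events have probability
  $1 - o(1)$: the noise \<open>X\<close> has operator norm at most $4 \sqrt n$ (Hoeffding and a union bound over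
  a lattice net of the ball), and all numbers of neighbours of a vertex in a cluster are close to
  their means. On these events every run is correct: both events are inherited by the subgraph on
  a union of clusters, so no union bound over the rounds of the recursion is needed.

  In one round, Weyl's inequality and a Davis-Kahan argument show that vectors of the range of
  $\hat P$ are at relative distance at most $\epsilon \le (p-q)/16$ from the span of the cluster
  vectors. In Frobenius norm this gives a column \<open>j\<close> at distance at most $\epsilon \sqrt{2/s}$ from
  the scaled cluster indicator. As \<open>W\<^sub>j\<close> collects the largest entries of this very column,
  $\|\hat P 1_{W_j}\|^2 \ge (1 - 2\epsilon^2) s$, and the maximiser is at least as good. Comparing
  with the projection onto the cluster vectors, the maximising set has at least $(1 - 4\epsilon) s$
  elements in one cluster, and then counting neighbours separates this cluster from the rest.
\<close>

section \<open>Symmetric matrices indexed by a finite set\<close>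

text \<open>That the set of possible results equals \<open>{\<C>}\<close> has two halves: no run
  errs, and some run exists. The second half is why the spectral theorem is proved: a run needs an
  ordered eigenbasis. The main obstacle is dependence: \<open>W j\<close> is computed from the
  graph, so neither its neighbour counts nor the graphs of later rounds are fresh randomness. Hence
  everything random is fixed in advance for the whole graph: a bound on the noise form, and the
  degree of every vertex into every original cluster. The rest is deterministic. Both conditions
  survive the removal of whole clusters, and \<open>s\<close>, hence the spectral gap, never
  changes. Constants: with \<open>M = 4 * sqrt n\<close> the condition on \<open>s\<close> gives
  \<open>e <= (p - q) / 16\<close>, so \<open>W j\<close> misses at most
  \<open>(p - q) * s / 4\<close> vertices of its cluster. Degree deviations cost another
  \<open>(p - q) * s / 8\<close>. Both losses occur once inside and once outside the cluster, which
  leaves \<open>(p - q) * s / 4\<close> to separate the two kinds of vertices.\<close>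

lemma homogeneous_system_solution:
  fixes a :: "'j \<Rightarrow> 'i \<Rightarrow> real"
  assumes "finite J" "finite I" "card J < card I"
  shows "\<exists>c. (\<exists>i\<in>I. c i \<noteq> 0) \<and> (\<forall>j\<in>J. (\<Sum>i\<in>I. a j i * c i) = 0)"
  using assms
proof (induction J arbitrary: I a rule: finite_induct)
  case empty
  then have "I \<noteq> {}" by auto
  then show ?case by (intro exI[of _ "\<lambda>_. 1"]) auto
next
  case (insert j J)
  show ?case
  proof (cases "\<forall>i\<in>I. a j i = 0")
    case True
    obtain c where "\<exists>i\<in>I. c i \<noteq> 0" "\<forall>j\<in>J. (\<Sum>i\<in>I. a j i * c i) = 0"
      using insert.IH[of I a] insert.prems insert.hyps by auto
    then show ?thesis using True by (intro exI[of _ c]) auto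
  next
    case False
    then obtain i0 where i0: "i0 \<in> I" "a j i0 \<noteq> 0" by auto
    \<comment> \<open>Gaussian elimination with pivot \<open>a j i0\<close>: the unknown
      \<open>i0\<close> is eliminated from the other rows, and \<open>r\<close> is the value that
      row \<open>j\<close> then forces on it.\<close>
    define I' where "I' = I - {i0}"
    have fin: "finite I'" and I: "I = insert i0 I'" "i0 \<notin> I'"
      using i0 insert.prems by (auto simp: I'_def)
    have "card J < card I'"
      using insert.prems insert.hyps I fin by simp
    then obtain c where c: "\<exists>i\<in>I'. c i \<noteq> 0"
      "\<forall>j'\<in>J. (\<Sum>i\<in>I'. (a j' i - a j' i0 * a j i / a j i0) * c i) = 0"
      using insert.IH[of I' "\<lambda>j' i. a j' i - a j' i0 * a j i / a j i0"] fin by auto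
    define r where "r = - (\<Sum>i\<in>I'. a j i * c i) / a j i0"
    define d where "d = c(i0 := r)"
    have sum_d: "(\<Sum>i\<in>I. a j' i * d i) = a j' i0 * r + (\<Sum>i\<in>I'. a j' i * c i)" for j'
    proof -
      have "(\<Sum>i\<in>I'. a j' i * d i) = (\<Sum>i\<in>I'. a j' i * c i)"
        using I by (intro sum.cong) (auto simp: d_def)
      then show ?thesis using I fin by (simp add: d_def)
    qed
    have "(\<Sum>i\<in>I. a j' i * d i) = 0" if "j' \<in> J" for j'
    proof -
      have "0 = (\<Sum>i\<in>I'. (a j' i - a j' i0 * a j i / a j i0) * c i)"
        using c that by auto
      also have "\<dots> = (\<Sum>i\<in>I'. a j' i * c i) + a j' i0 * r"
        by (simp add: r_def left_diff_distrib sum_subtractf sum_distrib_left sum_divide_distrib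
            mult.assoc algebra_simps)
      finally show ?thesis by (simp add: sum_d)
    qed
    moreover have "(\<Sum>i\<in>I. a j i * d i) = 0"
      using i0 by (simp add: sum_d r_def)
    moreover have "\<exists>i\<in>I. d i \<noteq> 0"
      using c(1) I by (metis d_def fun_upd_other insertCI)
    ultimately show ?thesis by (intro exI[of _ d]) auto
  qed
qed

section \<open>Bilinear algebra of inner products and matrix-vector products\<close>

lemma inner_on_commute: "inner_on V x y = inner_on V y x"
  by (simp add: inner_on_def mult.commute)

lemma inner_on_cong:
  "(\<And>i. i \<in> V \<Longrightarrow> x i = x' i) \<Longrightarrow> (\<And>i. i \<in> V \<Longrightarrow> y i = y' i) \<Longrightarrow>
     inner_on V x y = inner_on V x' y'"
  by (simp add: inner_on_def)

lemma inner_on_add_left: "inner_on V (\<lambda>i. x i + y i) z = inner_on V x z + inner_on V y z"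
  by (simp add: inner_on_def sum.distrib algebra_simps)

lemma inner_on_add_right: "inner_on V z (\<lambda>i. x i + y i) = inner_on V z x + inner_on V z y"
  by (simp add: inner_on_def sum.distrib algebra_simps)

lemma inner_on_diff_left: "inner_on V (\<lambda>i. x i - y i) z = inner_on V x z - inner_on V y z"
  by (simp add: inner_on_def sum_subtractf algebra_simps)

lemma inner_on_diff_right: "inner_on V z (\<lambda>i. x i - y i) = inner_on V z x - inner_on V z y"
  by (simp add: inner_on_def sum_subtractf algebra_simps)

lemma inner_on_scale_left: "inner_on V (\<lambda>i. c * x i) y = c * inner_on V x y"
  by (simp add: inner_on_def sum_distrib_left algebra_simps)

lemma inner_on_scale_right: "inner_on V y (\<lambda>i. c * x i) = c * inner_on V y x"
  by (simp add: inner_on_def sum_distrib_left algebra_simps)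

lemma inner_on_sum_left:
  "inner_on V (\<lambda>i. \<Sum>a\<in>I. c a * u a i) y = (\<Sum>a\<in>I. c a * inner_on V (u a) y)"
  unfolding inner_on_def sum_distrib_left sum_distrib_right
  by (subst sum.swap) (simp add: mult.assoc)

lemma inner_on_sum_right:
  "inner_on V y (\<lambda>i. \<Sum>a\<in>I. c a * u a i) = (\<Sum>a\<in>I. c a * inner_on V y (u a))"
  by (subst inner_on_commute) (simp add: inner_on_sum_left inner_on_commute)

lemma inner_on_ge_0: "inner_on V x x \<ge> 0"
  by (simp add: inner_on_def sum_nonneg)

lemma inner_on_eq_0: "finite V \<Longrightarrow> inner_on V x x = 0 \<longleftrightarrow> (\<forall>i\<in>V. x i = 0)"
  by (simp add: inner_on_def sum_nonneg_eq_0_iff)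

lemma L2_set_power2: "(L2_set x V)\<^sup>2 = inner_on V x x"
  by (simp add: L2_set_def inner_on_def sum_nonneg power2_eq_square)

lemma L2_set_eq_sqrt: "L2_set x V = sqrt (inner_on V x x)"
  by (simp add: L2_set_def inner_on_def power2_eq_square)

lemma abs_inner_on_le: "\<bar>inner_on V x y\<bar> \<le> L2_set x V * L2_set y V"
proof -
  have "\<bar>inner_on V x y\<bar> \<le> (\<Sum>i\<in>V. \<bar>x i\<bar> * \<bar>y i\<bar>)"
    unfolding inner_on_def abs_mult[symmetric] by (rule sum_abs)
  then show ?thesis using L2_set_mult_ineq[of x y V] by linarith
qed

definition symmetric_on :: "nat set \<Rightarrow> (nat \<Rightarrow> nat \<Rightarrow> real) \<Rightarrow> bool" where
  "symmetric_on V A \<longleftrightarrow> (\<forall>i\<in>V. \<forall>j\<in>V. A i j = A j i)"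

lemma inner_on_mat_vec:
  "inner_on V x (mat_vec_on V A y) = (\<Sum>i\<in>V. \<Sum>j\<in>V. x i * y j * A i j)"
  by (simp add: inner_on_def mat_vec_on_def sum_distrib_left algebra_simps)

lemma inner_on_mat_vec_symmetric:
  assumes "symmetric_on V A"
  shows "inner_on V x (mat_vec_on V A y) = inner_on V (mat_vec_on V A x) y"
proof -
  have "inner_on V (mat_vec_on V A x) y = (\<Sum>i\<in>V. \<Sum>j\<in>V. y i * x j * A i j)"
    by (subst inner_on_commute) (rule inner_on_mat_vec)
  also have "\<dots> = (\<Sum>j\<in>V. \<Sum>i\<in>V. y i * x j * A i j)"
    by (rule sum.swap)
  also have "\<dots> = inner_on V x (mat_vec_on V A y)"
    unfolding inner_on_mat_vec using assms
    by (intro sum.cong refl) (auto simp: symmetric_on_def)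
  finally show ?thesis by simp
qed

lemma mat_vec_on_add: "mat_vec_on V A (\<lambda>i. x i + y i) = (\<lambda>i. mat_vec_on V A x i + mat_vec_on V A y i)"
  by (auto simp: mat_vec_on_def sum.distrib algebra_simps)

lemma mat_vec_on_diff: "mat_vec_on V A (\<lambda>i. x i - y i) = (\<lambda>i. mat_vec_on V A x i - mat_vec_on V A y i)"
  by (auto simp: mat_vec_on_def sum_subtractf algebra_simps)

lemma mat_vec_on_scale: "mat_vec_on V A (\<lambda>i. c * x i) = (\<lambda>i. c * mat_vec_on V A x i)"
  by (auto simp: mat_vec_on_def sum_distrib_left algebra_simps)

lemma mat_vec_on_sum:
  "mat_vec_on V A (\<lambda>i. \<Sum>a\<in>I. c a * u a i) = (\<lambda>i. \<Sum>a\<in>I. c a * mat_vec_on V A (u a) i)"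
  unfolding mat_vec_on_def sum_distrib_left
  by (rule ext, subst sum.swap) (simp add: algebra_simps)

section \<open>Orthonormal families and projection onto their span\<close>

definition orthonormal_on :: "nat set \<Rightarrow> 'a set \<Rightarrow> ('a \<Rightarrow> nat \<Rightarrow> real) \<Rightarrow> bool" where
  "orthonormal_on V I w \<longleftrightarrow> (\<forall>a\<in>I. \<forall>b\<in>I. inner_on V (w a) (w b) = (if a = b then 1 else 0))"

text \<open>The index type is left open because two kinds of families occur: eigenvectors indexed by
  numbers and cluster vectors indexed by the clusters themselves.\<close>

definition proj_on :: "nat set \<Rightarrow> 'a set \<Rightarrow> ('a \<Rightarrow> nat \<Rightarrow> real) \<Rightarrow> (nat \<Rightarrow> real) \<Rightarrow> nat \<Rightarrow> real" where
  "proj_on V I w x i = (\<Sum>a\<in>I. inner_on V x (w a) * w a i)"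

lemma inner_on_proj:
  "inner_on V (proj_on V I w x) y = (\<Sum>a\<in>I. inner_on V x (w a) * inner_on V y (w a))"
  unfolding proj_on_def[abs_def] by (simp add: inner_on_sum_left inner_on_commute)

lemma inner_on_comb_orthonormal:
  assumes "orthonormal_on V I w" "finite I" "b \<in> I"
  shows "inner_on V (\<lambda>i. \<Sum>a\<in>I. c a * w a i) (w b) = c b"
proof -
  have "inner_on V (\<lambda>i. \<Sum>a\<in>I. c a * w a i) (w b) = (\<Sum>a\<in>I. c a * (if a = b then 1 else 0))"
    unfolding inner_on_sum_left using assms
    by (intro sum.cong) (auto simp: orthonormal_on_def)
  then show ?thesis using assms by (simp add: if_distrib cong: if_cong)
qed

lemma inner_on_comb_comb:
  assumes "orthonormal_on V I w" "finite I"
  shows "inner_on V (\<lambda>i. \<Sum>a\<in>I. c a * w a i) (\<lambda>i. \<Sum>a\<in>I. d a * w a i) = (\<Sum>a\<in>I. c a * d a)"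
  using assms by (subst inner_on_sum_right) (simp add: inner_on_comb_orthonormal mult.commute)

lemma inner_on_proj_basis:
  assumes "orthonormal_on V I w" "finite I" "b \<in> I"
  shows "inner_on V (proj_on V I w x) (w b) = inner_on V x (w b)"
  using inner_on_comb_orthonormal[OF assms] by (simp add: proj_on_def[abs_def])

lemma inner_on_proj_proj:
  assumes "orthonormal_on V I w" "finite I"
  shows "inner_on V (proj_on V I w x) (proj_on V I w y) = inner_on V (proj_on V I w x) y"
  unfolding inner_on_proj[of V I w x]
  by (intro sum.cong refl) (simp add: inner_on_proj_basis[OF assms])

lemma inner_on_proj_self:
  assumes "orthonormal_on V I w" "finite I"
  shows "inner_on V (proj_on V I w x) (proj_on V I w x) = (\<Sum>a\<in>I. (inner_on V x (w a))\<^sup>2)"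
  by (rule trans[OF inner_on_proj_proj[OF assms]]) (simp add: inner_on_proj power2_eq_square)

lemma inner_on_residual:
  assumes "orthonormal_on V I w" "finite I"
  shows "inner_on V (\<lambda>i. x i - proj_on V I w x i) (\<lambda>i. x i - proj_on V I w x i)
    = inner_on V x x - (\<Sum>a\<in>I. (inner_on V x (w a))\<^sup>2)"
  using inner_on_proj_self[OF assms, of x] inner_on_proj[of V I w x x]
  by (simp add: inner_on_diff_left inner_on_diff_right inner_on_commute[of V x "proj_on V I w x"]
      power2_eq_square)

lemma residual_orthogonal:
  assumes "orthonormal_on V I w" "finite I" "b \<in> I"
  shows "inner_on V (\<lambda>i. x i - proj_on V I w x i) (w b) = 0"
  by (simp add: inner_on_diff_left inner_on_proj_basis[OF assms])

text \<open>Dimension count: the residual \<open>z\<close> and the \<open>card V\<close> members of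
  the family are linearly dependent. The index \<open>None\<close> stands for \<open>z\<close>.
  Pairing the relation with each \<open>w b\<close> kills the other coefficients, so
  \<open>z\<close> vanishes on \<open>V\<close>.\<close>

lemma orthonormal_basis_complete:
  assumes "orthonormal_on V I w" "finite I" "finite V" "card V = card I" "i \<in> V"
  shows "x i = proj_on V I w x i"
proof -
  define z where "z = (\<lambda>i. x i - proj_on V I w x i)"
  have zw: "inner_on V z (w b) = 0" if "b \<in> I" for b
    unfolding z_def by (rule residual_orthogonal[OF assms(1,2) that])
  have "\<exists>c. (\<exists>e\<in>insert None (Some ` I). c e \<noteq> 0) \<and>
     (\<forall>i\<in>V. (\<Sum>e\<in>insert None (Some ` I). (case e of None \<Rightarrow> z i | Some a \<Rightarrow> w a i) * c e) = 0)"
    by (rule homogeneous_system_solution) (use assms in \<open>auto simp: card_image card_insert_if\<close>)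
  then obtain c where c: "\<exists>e\<in>insert None (Some ` I). c e \<noteq> 0"
    "\<forall>i\<in>V. (\<Sum>e\<in>insert None (Some ` I). (case e of None \<Rightarrow> z i | Some a \<Rightarrow> w a i) * c e) = 0"
    by blast
  have "(\<Sum>e\<in>insert None (Some ` I). (case e of None \<Rightarrow> z i | Some a \<Rightarrow> w a i) * c e)
      = z i * c None + (\<Sum>a\<in>I. c (Some a) * w a i)" for i
    using assms by (subst sum.insert) (auto simp: sum.reindex mult.commute)
  then have rel: "z i * c None + (\<Sum>a\<in>I. c (Some a) * w a i) = 0" if "i \<in> V" for i
    using c(2) that by simp
  have expand: "0 = c None * inner_on V z y + inner_on V (\<lambda>i. \<Sum>a\<in>I. c (Some a) * w a i) y" for y
  proof -
    have "0 = inner_on V (\<lambda>i. z i * c None + (\<Sum>a\<in>I. c (Some a) * w a i)) y"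
      using rel by (simp add: inner_on_def)
    also have "\<dots> = inner_on V (\<lambda>i. c None * z i + (\<Sum>a\<in>I. c (Some a) * w a i)) y"
      by (simp add: mult.commute)
    finally show ?thesis by (simp only: inner_on_add_left inner_on_scale_left)
  qed
  have cb: "c (Some b) = 0" if "b \<in> I" for b
    using expand[of "w b"] zw[OF that] inner_on_comb_orthonormal[OF assms(1,2) that] by simp
  then have "c None \<noteq> 0" using c(1) by auto
  moreover have "c None * z i = 0" using rel[OF \<open>i \<in> V\<close>] cb by auto
  ultimately show ?thesis by (simp add: z_def)
qed

section \<open>Spectral theorem by successive maximisation of the quadratic form\<close>

lemma exists_unit_orthogonal:
  assumes "finite V" "l < card V"
  shows "\<exists>x. inner_on V x x = 1 \<and> (\<forall>a<l. inner_on V x (u a) = 0)"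
proof -
  obtain c where c: "\<exists>i\<in>V. c i \<noteq> 0" "\<forall>a\<in>{..<l}. (\<Sum>i\<in>V. u a i * c i) = 0"
    using homogeneous_system_solution[of "{..<l}" V u] assms by auto
  define N where "N = inner_on V c c"
  have "N > 0" using inner_on_ge_0[of V c] inner_on_eq_0[OF assms(1), of c] c(1)
    by (auto simp: N_def order_less_le)
  then have "inner_on V (\<lambda>i. 1 / sqrt N * c i) (\<lambda>i. 1 / sqrt N * c i) = 1"
    unfolding inner_on_scale_left inner_on_scale_right N_def[symmetric] by simp
  moreover have "inner_on V (\<lambda>i. 1 / sqrt N * c i) (u a) = 0" if "a < l" for a
    unfolding inner_on_scale_left using c(2) that by (simp add: inner_on_def mult.commute)
  ultimately show ?thesis by blast
qed

text \<open>Compactness of the unit sphere. Vectors are functions on all of \<open>nat\<close>, so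
  their values outside \<open>V\<close> are pinned to 0 in \<open>B\<close>; truncation brings any
  vector there without changing a form. Homogeneity then removes the normalisation of
  \<open>y\<close>.\<close>

lemma constrained_maximizer:
  assumes "finite V" "l < card V"
  shows "\<exists>x. inner_on V x x = 1 \<and> (\<forall>a<l. inner_on V x (u a) = 0) \<and>
    (\<forall>y. (\<forall>a<l. inner_on V y (u a) = 0) \<longrightarrow>
      inner_on V y (mat_vec_on V A y) \<le> inner_on V x (mat_vec_on V A x) * inner_on V y y)"
proof -
  define B :: "(nat \<Rightarrow> real) set" where "B = PiE UNIV (\<lambda>i. if i \<in> V then {-1..1} else {0})"
  define K where "K = B \<inter> ({x. inner_on V x x = 1} \<inter> (\<Inter>a<l. {x. inner_on V x (u a) = 0}))"
  define Q where "Q = (\<lambda>x. inner_on V x (mat_vec_on V A x))"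
  have "compact B"
    unfolding B_def
    by (subst compactin_euclidean_iff[symmetric], subst euclidean_product_topology[symmetric],
        subst compactin_PiE) auto
  moreover have "closed ({x. inner_on V x x = 1} \<inter> (\<Inter>a<l. {x. inner_on V x (u a) = 0}))"
    unfolding inner_on_def
    by (intro closed_Int closed_INT ballI closed_Collect_eq continuous_intros
        continuous_on_product_then_coordinatewise continuous_on_id)
  ultimately have "compact K" unfolding K_def by (rule compact_Int_closed)
  moreover have "continuous_on K Q"
    unfolding Q_def inner_on_def mat_vec_on_def
    by (intro continuous_intros continuous_on_product_then_coordinatewise continuous_on_id)
  moreover have trunc: "(\<lambda>i. if i \<in> V then x i else 0) \<in> K"
    if "inner_on V x x = 1" "\<forall>a<l. inner_on V x (u a) = 0" for x
  proof -
    have "\<bar>x i\<bar> \<le> 1" if "i \<in> V" for i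
    proof -
      have "(x i)\<^sup>2 \<le> inner_on V x x"
        unfolding inner_on_def using \<open>finite V\<close> that
        by (metis (no_types, lifting) member_le_sum power2_eq_square zero_le_square)
      then show ?thesis using \<open>inner_on V x x = 1\<close> by (simp add: abs_square_le_1)
    qed
    then show ?thesis
      using that unfolding K_def B_def by (auto simp: inner_on_def abs_le_iff minus_le_iff)
  qed
  moreover have "K \<noteq> {}"
    using exists_unit_orthogonal[OF assms, of u] trunc by blast
  ultimately obtain x where x: "x \<in> K" "\<And>y. y \<in> K \<Longrightarrow> Q y \<le> Q x"
    using continuous_attains_sup[of K Q] by auto
  have Qtrunc: "Q (\<lambda>i. if i \<in> V then y i else 0) = Q y" for y
    by (simp add: Q_def inner_on_def mat_vec_on_def)
  have "Q y \<le> Q x * inner_on V y y" if y: "\<forall>a<l. inner_on V y (u a) = 0" for y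
  proof (cases "inner_on V y y = 0")
    case True
    then have "Q y = 0" using inner_on_eq_0[OF assms(1), of y] by (simp add: Q_def inner_on_def)
    then show ?thesis using True by simp
  next
    case False
    define N where "N = inner_on V y y"
    have "N > 0" using False inner_on_ge_0[of V y] by (simp add: N_def)
    define y' where "y' = (\<lambda>i. 1 / sqrt N * y i)"
    have "inner_on V y' y' = 1" "\<forall>a<l. inner_on V y' (u a) = 0"
      unfolding y'_def inner_on_scale_left inner_on_scale_right N_def[symmetric]
      using y \<open>N > 0\<close> by simp_all
    from trunc[OF this] have "Q y' \<le> Q x" using x(2) Qtrunc by metis
    moreover have "Q y' = Q y / N"
      unfolding Q_def y'_def mat_vec_on_scale inner_on_scale_left inner_on_scale_right
      using \<open>N > 0\<close> by (simp add: field_simps)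
    ultimately show ?thesis using \<open>N > 0\<close> by (simp add: N_def[symmetric] field_simps)
  qed
  moreover have "inner_on V x x = 1" "\<forall>a<l. inner_on V x (u a) = 0"
    using x(1) by (auto simp: K_def)
  ultimately show ?thesis unfolding Q_def by blast
qed

text \<open>First-order condition for a maximum at \<open>t = 0\<close>. The test value
  \<open>t = r * b\<close> is so small that the quadratic term cannot outweigh the linear
  one.\<close>

lemma linear_coefficient_zero:
  fixes b d :: real
  assumes "\<And>t. t * b + t\<^sup>2 * d \<le> 0"
  shows "b = 0"
proof (rule ccontr)
  assume "b \<noteq> 0"
  define r where "r = 1 / (1 + \<bar>d\<bar>)"
  have r: "r > 0" "r * \<bar>d\<bar> < 1" by (auto simp: r_def field_simps)
  have "r * b * b + (r * b)\<^sup>2 * d \<le> 0" by (rule assms)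
  moreover have "r * b * b + (r * b)\<^sup>2 * d = r * b\<^sup>2 * (1 + r * d)"
    by (simp add: algebra_simps power2_eq_square)
  moreover have "1 + r * d > 0"
  proof -
    have "\<bar>r * d\<bar> < 1" using r by (simp add: abs_mult)
    then show ?thesis by linarith
  qed
  ultimately show False using r \<open>b \<noteq> 0\<close>
    by (metis mult_pos_pos not_le zero_less_power2)
qed

text \<open>By symmetry \<open>A\<close> preserves the complement of the earlier eigenvectors, so
  the defect \<open>z\<close> is an admissible direction. Along \<open>x + t * z\<close> the
  derivative at \<open>t = 0\<close> is twice the squared norm of \<open>z\<close>, which must
  therefore vanish.\<close>

lemma constrained_maximizer_eigenvector:
  assumes "finite V" "symmetric_on V A"
    and inv: "\<And>a. a < l \<Longrightarrow> \<forall>i\<in>V. mat_vec_on V A (u a) i = \<mu> a * u a i"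
    and x: "inner_on V x x = 1" "\<forall>a<l. inner_on V x (u a) = 0"
    and max: "\<And>y. (\<forall>a<l. inner_on V y (u a) = 0) \<Longrightarrow>
      inner_on V y (mat_vec_on V A y) \<le> m * inner_on V y y"
    and m: "m = inner_on V x (mat_vec_on V A x)"
  shows "eigenvector_on V A x m"
proof -
  define z where "z = (\<lambda>i. mat_vec_on V A x i - m * x i)"
  have z_orth: "inner_on V z (u a) = 0" if "a < l" for a
  proof -
    have "inner_on V (mat_vec_on V A x) (u a) = inner_on V x (mat_vec_on V A (u a))"
      by (rule inner_on_mat_vec_symmetric[OF assms(2), symmetric])
    also have "\<dots> = inner_on V x (\<lambda>i. \<mu> a * u a i)"
      using inv[OF that] by (intro inner_on_cong) auto
    finally show ?thesis
      using x(2) that by (simp add: z_def inner_on_diff_left inner_on_scale_left inner_on_scale_right)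
  qed
  have "t * (2 * inner_on V z z) + t\<^sup>2 * (inner_on V z (mat_vec_on V A z) - m * inner_on V z z) \<le> 0" for t
  proof -
    define y where "y = (\<lambda>i. x i + t * z i)"
    have "inner_on V y (u a) = 0" if "a < l" for a
      using x(2) z_orth that by (simp add: y_def inner_on_add_left inner_on_scale_left)
    then have "inner_on V y (mat_vec_on V A y) \<le> m * inner_on V y y" by (intro max) auto
    moreover have "inner_on V y (mat_vec_on V A y) = m + 2 * t * inner_on V z (mat_vec_on V A x)
        + t\<^sup>2 * inner_on V z (mat_vec_on V A z)"
      using inner_on_mat_vec_symmetric[OF assms(2), of x z]
      by (simp add: y_def m mat_vec_on_add mat_vec_on_scale inner_on_add_left inner_on_add_right
          inner_on_scale_left inner_on_scale_right inner_on_commute[of V "mat_vec_on V A x" z]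
          power2_eq_square algebra_simps)
    moreover have "inner_on V y y = 1 + 2 * t * inner_on V z x + t\<^sup>2 * inner_on V z z"
      using x(1)
      by (simp add: y_def inner_on_add_left inner_on_add_right inner_on_commute[of V x z]
          inner_on_scale_left inner_on_scale_right power2_eq_square algebra_simps)
    moreover have "inner_on V z z = inner_on V z (mat_vec_on V A x) - m * inner_on V z x"
      by (subst (2) z_def) (simp add: inner_on_diff_right inner_on_scale_right)
    ultimately show ?thesis by (simp only:) (simp add: algebra_simps)
  qed
  from linear_coefficient_zero[OF this] have "inner_on V z z = 0" by simp
  then have "\<forall>i\<in>V. mat_vec_on V A x i = m * x i"
    using inner_on_eq_0[OF assms(1), of z] by (simp add: z_def)
  moreover have "\<exists>i\<in>V. x i \<noteq> 0"
    using x(1) inner_on_eq_0[OF assms(1), of x] by auto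
  ultimately show ?thesis by (auto simp: eigenvector_on_def)
qed

text \<open>The induction also carries the maximality of each \<open>\<mu> a\<close> on the
  complement of the earlier vectors. This yields the ordering: for \<open>a <= b\<close> the vector
  \<open>u b\<close> was a competitor when \<open>u a\<close> was chosen.\<close>

theorem ordered_eigenbasis_exists:
  assumes "finite V" "symmetric_on V A"
  shows "\<exists>u \<mu>. ordered_eigenbasis V A u \<mu>"
proof -
  have "\<exists>u \<mu>. (\<forall>a<l. eigenvector_on V A (u a) (\<mu> a)) \<and>
      (\<forall>a<l. \<forall>b<l. inner_on V (u a) (u b) = (if a = b then 1 else 0)) \<and>
      (\<forall>a<l. \<forall>y. (\<forall>b<a. inner_on V y (u b) = 0) \<longrightarrow>
         inner_on V y (mat_vec_on V A y) \<le> \<mu> a * inner_on V y y)"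
    if "l \<le> card V" for l
    using that
  proof (induction l)
    case 0
    then show ?case by simp
  next
    case (Suc l)
    then obtain u \<mu> where u: "(\<forall>a<l. eigenvector_on V A (u a) (\<mu> a)) \<and>
      (\<forall>a<l. \<forall>b<l. inner_on V (u a) (u b) = (if a = b then 1 else 0)) \<and>
      (\<forall>a<l. \<forall>y. (\<forall>b<a. inner_on V y (u b) = 0) \<longrightarrow>
         inner_on V y (mat_vec_on V A y) \<le> \<mu> a * inner_on V y y)"
      by auto
    then have eig: "\<And>a. a < l \<Longrightarrow> eigenvector_on V A (u a) (\<mu> a)" and
      orth: "\<And>a b. a < l \<Longrightarrow> b < l \<Longrightarrow> inner_on V (u a) (u b) = (if a = b then 1 else 0)" and
      maxi: "\<And>a y. a < l \<Longrightarrow> (\<forall>b<a. inner_on V y (u b) = 0) \<Longrightarrow>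
         inner_on V y (mat_vec_on V A y) \<le> \<mu> a * inner_on V y y"
      by blast+
    obtain x where x: "inner_on V x x = 1" "\<forall>a<l. inner_on V x (u a) = 0"
      "\<And>y. (\<forall>a<l. inner_on V y (u a) = 0) \<Longrightarrow>
      inner_on V y (mat_vec_on V A y) \<le> inner_on V x (mat_vec_on V A x) * inner_on V y y"
      using constrained_maximizer[OF assms(1), of l u A] Suc.prems by auto
    define m where "m = inner_on V x (mat_vec_on V A x)"
    have "eigenvector_on V A x m"
      by (rule constrained_maximizer_eigenvector[OF assms, of l u \<mu>])
        (use x eig in \<open>auto simp: m_def eigenvector_on_def\<close>)
    then have 1: "eigenvector_on V A ((u(l := x)) a) ((\<mu>(l := m)) a)" if "a < Suc l" for a
      using eig that by (cases "a = l") auto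
    have xl: "inner_on V (u a) x = 0" if "a < l" for a
      using x(2) that by (subst inner_on_commute) blast
    have 2: "inner_on V ((u(l := x)) a) ((u(l := x)) b) = (if a = b then 1 else 0)"
      if "a < Suc l" "b < Suc l" for a b
      using orth[of a b] x(1,2) xl that by (cases "a = l"; cases "b = l") auto
    have 3: "inner_on V y (mat_vec_on V A y) \<le> (\<mu>(l := m)) a * inner_on V y y"
      if "a < Suc l" "\<forall>b<a. inner_on V y ((u(l := x)) b) = 0" for a y
    proof -
      have "\<forall>b<a. inner_on V y (u b) = 0" using that by fastforce
      then show ?thesis using that(1) x(3)[of y] maxi[of a y] by (cases "a = l") (auto simp: m_def)
    qed
    show ?case using 1 2 3 by blast
  qed
  from this[of "card V"] obtain u \<mu> where u: "(\<forall>a<card V. eigenvector_on V A (u a) (\<mu> a)) \<and>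
      (\<forall>a<card V. \<forall>b<card V. inner_on V (u a) (u b) = (if a = b then 1 else 0)) \<and>
      (\<forall>a<card V. \<forall>y. (\<forall>b<a. inner_on V y (u b) = 0) \<longrightarrow>
         inner_on V y (mat_vec_on V A y) \<le> \<mu> a * inner_on V y y)"
    by auto
  then have eig: "\<forall>a<card V. eigenvector_on V A (u a) (\<mu> a)" and
    orth: "\<forall>a<card V. \<forall>b<card V. inner_on V (u a) (u b) = (if a = b then 1 else 0)" and
    maxi: "\<And>a y. a < card V \<Longrightarrow> (\<forall>b<a. inner_on V y (u b) = 0) \<Longrightarrow>
         inner_on V y (mat_vec_on V A y) \<le> \<mu> a * inner_on V y y"
    by blast+
  have "\<mu> b \<le> \<mu> a" if "a \<le> b" "b < card V" for a b
  proof -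
    have "inner_on V (u b) (mat_vec_on V A (u b)) = inner_on V (u b) (\<lambda>i. \<mu> b * u b i)"
      using eig that by (intro inner_on_cong) (auto simp: eigenvector_on_def)
    also have "\<dots> = \<mu> b" using orth that by (simp add: inner_on_scale_right)
    finally show ?thesis using maxi[of a "u b"] orth that by auto
  qed
  then show ?thesis using eig orth unfolding ordered_eigenbasis_def by blast
qed

section \<open>The algorithm's projection in terms of eigenvectors\<close>

lemma ordered_eigenbasis_orthonormal:
  "ordered_eigenbasis V A u \<mu> \<Longrightarrow> l \<le> card V \<Longrightarrow> orthonormal_on V {..<l} u"
  by (auto simp: ordered_eigenbasis_def orthonormal_on_def)

text \<open>Testing the residual on \<open>u b\<close> forces the coefficient of \<open>u b\<close>.
  Any admissible matrix \<open>P\<close> can thus be traded for \<open>proj_on\<close>, whatever its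
  entries outside \<open>V\<close>.\<close>

lemma orthogonal_projection_on_span_first:
  assumes "orthonormal_on V {..<l} u" "orthogonal_projection_on V (span_first l u) P" "i \<in> V"
  shows "mat_vec_on V P x i = proj_on V {..<l} u x i"
proof -
  obtain c where c: "\<forall>i\<in>V. mat_vec_on V P x i = (\<Sum>a<l. c a * u a i)"
    using assms(2) unfolding orthogonal_projection_on_def span_first_def by blast
  have "inner_on V x (u b) = c b" if "b < l" for b
  proof -
    have "u b \<in> span_first l u"
      unfolding span_first_def using that
      by (auto intro!: exI[of _ "\<lambda>a. if a = b then 1 else 0"]
          simp: if_distrib if_distribR cong: if_cong)
    then have "inner_on V (\<lambda>i. x i - mat_vec_on V P x i) (u b) = 0"
      using assms(2) unfolding orthogonal_projection_on_def by blast
    then have "inner_on V x (u b) = inner_on V (mat_vec_on V P x) (u b)"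
      by (simp add: inner_on_diff_left)
    also have "\<dots> = inner_on V (\<lambda>i. \<Sum>a<l. c a * u a i) (u b)"
      using c by (intro inner_on_cong) auto
    also have "\<dots> = c b" using inner_on_comb_orthonormal[OF assms(1)] that by simp
    finally show ?thesis .
  qed
  then show ?thesis using c assms(3) by (simp add: proj_on_def)
qed

lemma top_projection_exists:
  assumes "finite V" "symmetric_on V A" "l \<le> card V"
  shows "\<exists>P. top_projection V A l P"
proof -
  obtain u \<mu> where u: "ordered_eigenbasis V A u \<mu>"
    using ordered_eigenbasis_exists[OF assms(1,2)] by blast
  define P where "P = (\<lambda>i j. \<Sum>a<l. u a i * u a j)"
  have on: "orthonormal_on V {..<l} u"
    using ordered_eigenbasis_orthonormal[OF u assms(3)] .
  have P: "mat_vec_on V P x = proj_on V {..<l} u x" for x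
    unfolding mat_vec_on_def P_def proj_on_def inner_on_def sum_distrib_right
    by (rule ext, subst sum.swap) (simp add: algebra_simps)
  have "inner_on V (\<lambda>i. x i - proj_on V {..<l} u x i) (\<lambda>i. \<Sum>a<l. c a * u a i) = 0" for x c
    using residual_orthogonal[OF on] by (simp add: inner_on_sum_right)
  then have "orthogonal_projection_on V (span_first l u) P"
    unfolding orthogonal_projection_on_def span_first_def P by (auto simp: proj_on_def)
  then show ?thesis using u unfolding top_projection_def by blast
qed

section \<open>Perturbation of the cluster subspace\<close>

text \<open>Exchange argument: \<open>W - C\<close> and \<open>C - W\<close> have equal size, and
  the largest value on \<open>C - W\<close> is a threshold below all values on
  \<open>W - C\<close>.\<close>

lemma sum_le_sum_if_dominated:
  fixes f :: "'a \<Rightarrow> real"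
  assumes "finite W" "finite C" "card W = card C"
    and dom: "\<And>a b. a \<in> W - C \<Longrightarrow> b \<in> C - W \<Longrightarrow> f b \<le> f a"
  shows "sum f C \<le> sum f W"
proof -
  have card: "card (W - C) = card (C - W)"
    using assms by (simp add: card_Diff_subset_Int Int_commute)
  have "sum f (C - W) \<le> sum f (W - C)"
  proof (cases "C - W = {}")
    case True
    then have "card (W - C) = 0" using card by (simp only: card.empty)
    then have "W - C = {}" using assms(1) by (simp only: card_0_eq finite_Diff)
    with True show ?thesis by (simp only: sum.empty)
  next
    case False
    define m where "m = Max (f ` (C - W))"
    have "m \<in> f ` (C - W)" unfolding m_def using False assms by (intro Max_in) auto
    then have "\<And>a. a \<in> W - C \<Longrightarrow> m \<le> f a" using dom by auto
    then have "of_nat (card (W - C)) * m \<le> sum f (W - C)" by (rule sum_bounded_below)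
    moreover have "sum f (C - W) \<le> of_nat (card (C - W)) * m"
      unfolding m_def using assms by (intro sum_bounded_above) auto
    ultimately show ?thesis using card by simp
  qed
  moreover have "sum f C = sum f (C \<inter> W) + sum f (C - W)"
    using assms by (simp add: sum.Int_Diff)
  moreover have "sum f W = sum f (C \<inter> W) + sum f (W - C)"
    using assms sum.Int_Diff[of W f C] by (simp add: Int_commute)
  ultimately show ?thesis by simp
qed

text \<open>The last property excludes \<open>a = j\<close>, since \<open>j\<close> enters
  \<open>W\<close> whatever its own entry \<open>P j j\<close> is.\<close>

lemma top_column_set_props:
  assumes "top_column_set V P s j W" "finite V" "j \<in> V" "0 < s" "s \<le> card V"
  shows "W \<subseteq> V" "j \<in> W" "card W = s"
    and "\<And>a b. a \<in> W \<Longrightarrow> a \<noteq> j \<Longrightarrow> b \<in> V - W \<Longrightarrow> P b j \<le> P a j"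
proof -
  obtain js where js: "distinct js" "set js = V - {j}" "sorted_wrt (\<lambda>a b. P a j \<ge> P b j) js"
    "W = insert j (set (take (s - 1) js))"
    using assms(1) unfolding top_column_set_def by blast
  show "W \<subseteq> V" using js assms by (auto dest: in_set_takeD)
  show "j \<in> W" using js by simp
  have "length js = card V - 1" using js assms by (metis card_Diff_singleton distinct_card)
  moreover have "j \<notin> set (take (s - 1) js)" using js by (auto dest: in_set_takeD)
  ultimately show "card W = s" using js assms by (simp add: distinct_card)
  fix a b assume ab: "a \<in> W" "a \<noteq> j" "b \<in> V - W"
  have "sorted_wrt (\<lambda>a b. P a j \<ge> P b j) (take (s - 1) js @ drop (s - 1) js)"
    using js by simp
  moreover have "a \<in> set (take (s - 1) js)" using ab js by auto
  moreover have "b \<in> set (drop (s - 1) js)"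
  proof -
    have "b \<in> set (take (s - 1) js @ drop (s - 1) js)" using ab js by simp
    then show ?thesis using ab js by (metis DiffD2 Un_iff insertI2 set_append)
  qed
  ultimately show "P b j \<le> P a j" unfolding sorted_wrt_append by blast
qed

lemma top_column_set_exists:
  assumes "finite V"
  shows "\<exists>W. top_column_set V P s j W"
proof -
  define js where "js = sort_key (\<lambda>a. - P a j) (sorted_list_of_set (V - {j}))"
  have "distinct js" "set js = V - {j}" using assms by (auto simp: js_def)
  moreover have "sorted (map (\<lambda>a. - P a j) js)" by (simp add: js_def)
  then have "sorted_wrt (\<lambda>a b. P a j \<ge> P b j) js" by (simp add: sorted_map)
  ultimately show ?thesis unfolding top_column_set_def by blast
qed

text \<open>One round, with \<open>V\<close> the remaining vertices. The \<open>p\<close> subtracted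
  on the diagonal accounts for the absence of loops. The noise is bounded as a bilinear form, since
  it will be applied to two different vectors, and \<open>M\<close> is not tied to the size of
  \<open>V\<close>.\<close>

locale perturbed_clusters =
  fixes V :: "nat set" and \<C> :: "nat set set" and s :: nat and p q M :: real
    and A X :: "nat \<Rightarrow> nat \<Rightarrow> real"
  assumes finite_V: "finite V" and partition: "partition_on V \<C>"
    and size: "\<And>C. C \<in> \<C> \<Longrightarrow> card C = s" and s_pos: "0 < s"
    and q_ge_0: "0 \<le> q" and nonempty: "\<C> \<noteq> {}"
    and decomposition: "\<And>i j. i \<in> V \<Longrightarrow> j \<in> V \<Longrightarrow>
      A i j = (if \<exists>C\<in>\<C>. i \<in> C \<and> j \<in> C then p else q) - (if i = j then p else 0) + X i j"
    and noise: "\<And>x y. \<bar>inner_on V x (mat_vec_on V X y)\<bar> \<le> M * L2_set x V * L2_set y V"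
    and M_ge_0: "0 \<le> M" and gap: "M < (p - q) * s"
begin

definition w :: "nat set \<Rightarrow> nat \<Rightarrow> real" where
  "w C i = indicator C i / sqrt s"

definition k :: nat where "k = card \<C>"

text \<open>
  Bounds the sine of the angle between the span of the top \<open>k\<close> eigenvectors and the span of the
  cluster vectors.
\<close>

definition e :: real where "e = M / ((p - q) * s - M)"

lemma finite_C: "finite \<C>"
  using finite_elements[OF finite_V partition] .

lemma cluster_subset: "C \<in> \<C> \<Longrightarrow> C \<subseteq> V"
  using partition by (auto simp: partition_on_def)

lemma cluster_unique: "C \<in> \<C> \<Longrightarrow> D \<in> \<C> \<Longrightarrow> i \<in> C \<Longrightarrow> i \<in> D \<Longrightarrow> C = D"
  using partition unfolding partition_on_def disjoint_def by blast

lemma sum_clusters: "(\<Sum>i\<in>V. f i) = (\<Sum>C\<in>\<C>. \<Sum>i\<in>C. f i)" for f :: "nat \<Rightarrow> real"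
proof -
  have "sum f (\<Union>\<C>) = (sum \<circ> sum) f \<C>"
    using partition finite_V cluster_subset
    by (intro sum.Union_disjoint) (auto simp: partition_on_def disjoint_def intro: finite_subset)
  then show ?thesis using partition by (simp add: partition_on_def)
qed

lemma card_V: "card V = k * s"
proof -
  have "real (card V) = (\<Sum>C\<in>\<C>. \<Sum>i\<in>C. 1)"
    using sum_clusters[of "\<lambda>_. 1"] by simp
  also have "\<dots> = real (k * s)" using size by (simp add: k_def)
  finally show ?thesis by (simp only: of_nat_eq_iff)
qed

lemma k_pos: "0 < k"
  using nonempty finite_C by (simp add: k_def card_gt_0_iff)

lemma k_le_card_V: "k \<le> card V"
  using card_V s_pos by simp

lemma s_le_card_V: "s \<le> card V"
  using card_V k_pos by simp

lemma sum_indicator_cluster: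
  fixes f :: "nat \<Rightarrow> real"
  assumes "C \<in> \<C>"
  shows "(\<Sum>i\<in>V. f i * indicator C i) = (\<Sum>i\<in>C. f i)"
  using cluster_subset[OF assms] finite_V
  by (simp add: sum.inter_restrict[symmetric] indicator_def if_distrib inf.absorb2 cong: if_cong)

lemma inner_w: "C \<in> \<C> \<Longrightarrow> inner_on V x (w C) = (\<Sum>i\<in>C. x i) / sqrt s"
  by (simp add: inner_on_def w_def sum_divide_distrib[symmetric] sum_indicator_cluster)

lemma orthonormal_w: "orthonormal_on V \<C> w"
proof -
  have "inner_on V (w C) (w D) = (if C = D then 1 else 0)" if "C \<in> \<C>" "D \<in> \<C>" for C D
  proof -
    have "(\<Sum>i\<in>D. w C i) = (\<Sum>i\<in>D. if C = D then 1 / sqrt s else 0)"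
      using cluster_unique[OF that] by (intro sum.cong) (auto simp: w_def indicator_def)
    then show ?thesis using size[OF that(2)] s_pos by (simp add: inner_w that)
  qed
  then show ?thesis by (simp add: orthonormal_on_def)
qed

text \<open>The all-ones vector lies in the cluster span, so the \<open>q\<close> part of the block
  matrix vanishes on vectors orthogonal to the clusters.\<close>

lemma sum_eq_inner_w: "(\<Sum>i\<in>V. x i) = sqrt s * (\<Sum>C\<in>\<C>. inner_on V x (w C))"
  using s_pos by (simp add: sum_clusters inner_w sum_divide_distrib[symmetric])

text \<open>The projection onto the cluster span has entry \<open>1 / s\<close> within a cluster and
  0 elsewhere; the block matrix is a combination of it and the all-ones matrix.\<close>

lemma same_cluster_sum:
  assumes "i \<in> V" "j \<in> V"
  shows "(if \<exists>C\<in>\<C>. i \<in> C \<and> j \<in> C then p else q) = q + (p - q) * (\<Sum>C\<in>\<C>. s * w C i * w C j)"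
proof -
  have eq: "s * w C i * w C j = (if i \<in> C \<and> j \<in> C then 1 else 0)" for C
    using s_pos by (simp add: w_def indicator_def)
  show ?thesis
  proof (cases "\<exists>C\<in>\<C>. i \<in> C \<and> j \<in> C")
    case True
    then obtain C0 where C0: "C0 \<in> \<C>" "i \<in> C0" "j \<in> C0" by blast
    have "(\<Sum>C\<in>\<C>. s * w C i * w C j) = (\<Sum>C\<in>\<C>. if C = C0 then 1 else 0)"
      unfolding eq using C0 cluster_unique by (intro sum.cong) auto
    then show ?thesis using True C0 finite_C by simp
  next
    case False
    then have "(\<Sum>C\<in>\<C>. s * w C i * w C j) = 0" unfolding eq by (intro sum.neutral) auto
    then show ?thesis by (simp only: False if_False mult_zero_right add_0_right)
  qed
qed

text \<open>The added multiple of the identity cancels the diagonal correction. Both spectral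
  estimates below rest on the resulting split into a multiple of the cluster projection, a rank-one
  part and the noise.\<close>

lemma shifted_form:
  "inner_on V x (mat_vec_on V A y) + p * inner_on V x y =
     (p - q) * s * (\<Sum>C\<in>\<C>. inner_on V x (w C) * inner_on V y (w C))
     + q * (\<Sum>i\<in>V. x i) * (\<Sum>i\<in>V. y i) + inner_on V x (mat_vec_on V X y)"
proof -
  have "inner_on V x (mat_vec_on V A y) = (\<Sum>i\<in>V. \<Sum>j\<in>V. x i * y j *
      (q + (p - q) * (\<Sum>C\<in>\<C>. s * w C i * w C j) - (if i = j then p else 0) + X i j))"
    unfolding inner_on_mat_vec by (intro sum.cong refl) (simp only: decomposition same_cluster_sum)
  also have "\<dots> = (\<Sum>i\<in>V. \<Sum>j\<in>V. x i * y j * q)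
      + (\<Sum>i\<in>V. \<Sum>j\<in>V. \<Sum>C\<in>\<C>. (p - q) * s * (x i * w C i * (y j * w C j)))
      - (\<Sum>i\<in>V. \<Sum>j\<in>V. if i = j then x i * y j * p else 0) + inner_on V x (mat_vec_on V X y)"
    unfolding inner_on_mat_vec sum.distrib[symmetric] sum_subtractf[symmetric]
    by (intro sum.cong refl) (simp add: sum_distrib_left algebra_simps)
  also have "(\<Sum>i\<in>V. \<Sum>j\<in>V. x i * y j * q) = q * (\<Sum>i\<in>V. x i) * (\<Sum>i\<in>V. y i)"
    by (simp add: sum_product sum_distrib_left algebra_simps)
  also have "(\<Sum>i\<in>V. \<Sum>j\<in>V. if i = j then x i * y j * p else 0) = p * inner_on V x y"
    using finite_V by (simp add: inner_on_def sum_distrib_left algebra_simps)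
  also have "(\<Sum>i\<in>V. \<Sum>j\<in>V. \<Sum>C\<in>\<C>. (p - q) * s * (x i * w C i * (y j * w C j)))
      = (\<Sum>i\<in>V. \<Sum>C\<in>\<C>. \<Sum>j\<in>V. (p - q) * s * (x i * w C i * (y j * w C j)))"
    by (intro sum.cong refl sum.swap)
  also have "\<dots> = (\<Sum>C\<in>\<C>. \<Sum>i\<in>V. \<Sum>j\<in>V. (p - q) * s * (x i * w C i * (y j * w C j)))"
    by (rule sum.swap)
  also have "\<dots> = (p - q) * s * (\<Sum>C\<in>\<C>. inner_on V x (w C) * inner_on V y (w C))"
    unfolding inner_on_def by (simp only: sum_product) (simp only: sum_distrib_left)
  finally show ?thesis by simp
qed

lemma e_ge_0: "0 \<le> e"
  using M_ge_0 gap by (simp add: e_def)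

context
  fixes u \<mu>
  assumes basis: "ordered_eigenbasis V A u \<mu>"
begin

lemma orthonormal_u: "orthonormal_on V {..<k} u"
  using ordered_eigenbasis_orthonormal[OF basis k_le_card_V] .

lemma inner_A_comb:
  assumes "l \<le> card V"
  shows "inner_on V z (mat_vec_on V A (\<lambda>i. \<Sum>a<l. c a * u a i)) = (\<Sum>a<l. c a * \<mu> a * inner_on V z (u a))"
proof -
  have "inner_on V z (mat_vec_on V A (u a)) = \<mu> a * inner_on V z (u a)" if "a < l" for a
  proof -
    have "inner_on V z (mat_vec_on V A (u a)) = inner_on V z (\<lambda>i. \<mu> a * u a i)"
      using basis assms that
      by (intro inner_on_cong) (auto simp: ordered_eigenbasis_def eigenvector_on_def)
    then show ?thesis by (simp add: inner_on_scale_right)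
  qed
  then show ?thesis by (simp add: mat_vec_on_sum inner_on_sum_right mult.assoc)
qed

text \<open>On the \<open>k\<close>-dimensional cluster span the shifted form is at least
  \<open>(p - q) * s - M\<close> times the squared norm, as the \<open>q\<close> part is
  nonnegative. Indices start at 0, so \<open>\<mu> (k - 1)\<close> is the \<open>k\<close>-th
  largest eigenvalue, and it bounds the form of \<open>A\<close> on vectors orthogonal to the first
  \<open>k - 1\<close> eigenvectors.\<close>

lemma top_eigenvalue_bound:
  assumes "a < k"
  shows "(p - q) * s - M \<le> \<mu> a + p"
proof -
  obtain c where c: "\<exists>C\<in>\<C>. c C \<noteq> 0" "\<forall>b\<in>{..<k-1}. (\<Sum>C\<in>\<C>. inner_on V (w C) (u b) * c C) = 0"
    using homogeneous_system_solution[of "{..<k-1}" \<C> "\<lambda>b C. inner_on V (w C) (u b)"]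
      finite_C k_pos by (auto simp: k_def)
  \<comment> \<open>Courant-Fischer: a cluster combination orthogonal to the first \<open>k - 1\<close> eigenvectors\<close>
  define x where "x = (\<lambda>i. \<Sum>C\<in>\<C>. c C * w C i)"
  have xu: "inner_on V x (u b) = 0" if "b < k - 1" for b
    using c(2) that by (simp add: x_def inner_on_sum_left mult.commute)
  have xw: "inner_on V x (w C) = c C" if "C \<in> \<C>" for C
    unfolding x_def by (rule inner_on_comb_orthonormal[OF orthonormal_w finite_C that])
  have xx: "inner_on V x x = (\<Sum>C\<in>\<C>. c C * c C)"
    unfolding x_def by (rule inner_on_comb_comb[OF orthonormal_w finite_C])
  have pos: "inner_on V x x > 0"
    unfolding xx using c(1) finite_C by (auto intro!: sum_pos2 simp: zero_less_mult_iff)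
  have on: "orthonormal_on V {..<card V} u"
    using ordered_eigenbasis_orthonormal[OF basis order_refl] .
  have complete: "x i = proj_on V {..<card V} u x i" if "i \<in> V" for i
    by (rule orthonormal_basis_complete[OF on _ finite_V _ that]) auto
  have "inner_on V x (mat_vec_on V A x)
      = inner_on V x (mat_vec_on V A (\<lambda>i. \<Sum>a<card V. inner_on V x (u a) * u a i))"
    using complete by (simp add: inner_on_mat_vec proj_on_def)
  also have "\<dots> = (\<Sum>a<card V. inner_on V x (u a) * \<mu> a * inner_on V x (u a))"
    by (rule inner_A_comb) simp
  also have "\<dots> \<le> (\<Sum>a<card V. \<mu> (k - 1) * (inner_on V x (u a))\<^sup>2)"
  proof (rule sum_mono)
    fix a assume a: "a \<in> {..<card V}"
    show "inner_on V x (u a) * \<mu> a * inner_on V x (u a) \<le> \<mu> (k - 1) * (inner_on V x (u a))\<^sup>2"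
    proof (cases "a < k - 1")
      case True
      then show ?thesis using xu by simp
    next
      case False
      then have "\<mu> a \<le> \<mu> (k - 1)" using basis a by (auto simp: ordered_eigenbasis_def)
      then have "\<mu> a * (inner_on V x (u a))\<^sup>2 \<le> \<mu> (k - 1) * (inner_on V x (u a))\<^sup>2"
        by (intro mult_right_mono) auto
      then show ?thesis by (simp add: power2_eq_square algebra_simps)
    qed
  qed
  also have "\<dots> = \<mu> (k - 1) * inner_on V x x"
  proof -
    have "inner_on V x x = inner_on V (proj_on V {..<card V} u x) x"
      using complete by (intro inner_on_cong) auto
    then show ?thesis by (simp add: inner_on_proj sum_distrib_left power2_eq_square)
  qed
  finally have upper: "inner_on V x (mat_vec_on V A x) \<le> \<mu> (k - 1) * inner_on V x x" .
  have "(\<Sum>C\<in>\<C>. inner_on V x (w C) * inner_on V x (w C)) = inner_on V x x"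
    using xx xw by simp
  moreover have "\<bar>inner_on V x (mat_vec_on V X x)\<bar> \<le> M * inner_on V x x"
    using noise[of x x] by (simp add: L2_set_power2[symmetric] power2_eq_square mult.assoc)
  moreover have "0 \<le> q * (\<Sum>i\<in>V. x i) * (\<Sum>i\<in>V. x i)"
    using q_ge_0 by (simp add: mult.assoc)
  ultimately have "((p - q) * s - M) * inner_on V x x \<le> (\<mu> (k - 1) + p) * inner_on V x x"
    using shifted_form[of x x] upper by (simp add: algebra_simps)
  then have "(p - q) * s - M \<le> \<mu> (k - 1) + p" using pos by simp
  moreover have "\<mu> (k - 1) \<le> \<mu> a"
  proof -
    have "a \<le> k - 1" "k - 1 < card V" using assms k_le_card_V by auto
    then show ?thesis using basis unfolding ordered_eigenbasis_def by blast
  qed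
  ultimately show ?thesis by simp
qed

text \<open>On the top eigenspace the shifted matrix is invertible with inverse of norm at most
  \<open>1 / g\<close>; \<open>x\<close> is the preimage of \<open>y\<close>. The residual
  \<open>z\<close> is orthogonal to the clusters, hence sees only the noise in the shifted form: the
  squared norm of \<open>z\<close> is the noise form at \<open>z\<close> and \<open>x\<close>, and
  the norm of \<open>x\<close> is at most that of \<open>y\<close> divided by
  \<open>g\<close>.\<close>

lemma residual_bound:
  assumes y: "y = (\<lambda>i. \<Sum>a<k. c a * u a i)"
  shows "L2_set (\<lambda>i. y i - proj_on V \<C> w y i) V \<le> e * L2_set y V"
proof -
  define g where "g = (p - q) * s - M"
  have g: "g > 0" using gap by (simp add: g_def)
  have \<mu>: "g \<le> \<mu> a + p" if "a < k" for a using top_eigenvalue_bound[OF that] by (simp add: g_def)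
  define x where "x = (\<lambda>i. \<Sum>a<k. (c a / (\<mu> a + p)) * u a i)"
  define z where "z = (\<lambda>i. y i - proj_on V \<C> w y i)"
  have zw: "inner_on V z (w C) = 0" if "C \<in> \<C>" for C
    unfolding z_def by (rule residual_orthogonal[OF orthonormal_w finite_C that])
  have zsum: "(\<Sum>i\<in>V. z i) = 0" unfolding sum_eq_inner_w using zw by simp
  have "inner_on V z (proj_on V \<C> w y) = 0"
    by (subst inner_on_commute) (simp add: inner_on_proj zw)
  then have "inner_on V z z = inner_on V z y"
    by (subst (2) z_def) (simp add: inner_on_diff_right)
  also have "inner_on V z y = (\<Sum>a<k. (c a / (\<mu> a + p)) * (\<mu> a + p) * inner_on V z (u a))"
    unfolding y inner_on_sum_right
    by (intro sum.cong refl) (use \<mu> g in force)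
  also have "\<dots> = inner_on V z (mat_vec_on V A x) + p * inner_on V z x"
    unfolding x_def inner_A_comb[OF k_le_card_V] inner_on_sum_right sum_distrib_left
      sum.distrib[symmetric]
    by (intro sum.cong refl) (simp only: distrib_left distrib_right mult_ac)
  also have "\<dots> = inner_on V z (mat_vec_on V X x)"
    unfolding shifted_form zsum using zw by simp
  also have "\<dots> \<le> M * L2_set z V * L2_set x V" using noise[of z x] by linarith
  finally have zz: "(L2_set z V)\<^sup>2 \<le> M * L2_set z V * L2_set x V" by (simp add: L2_set_power2)
  have "g\<^sup>2 * inner_on V x x \<le> inner_on V y y"
  proof -
    have "inner_on V x x = (\<Sum>a<k. (c a / (\<mu> a + p)) * (c a / (\<mu> a + p)))"
      unfolding x_def by (rule inner_on_comb_comb[OF orthonormal_u]) simp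
    moreover have "inner_on V y y = (\<Sum>a<k. c a * c a)"
      unfolding y by (rule inner_on_comb_comb[OF orthonormal_u]) simp
    moreover have "g\<^sup>2 * ((c a / (\<mu> a + p)) * (c a / (\<mu> a + p))) \<le> c a * c a" if "a < k" for a
    proof -
      have "g\<^sup>2 \<le> (\<mu> a + p)\<^sup>2" using \<mu>[OF that] g by (intro power_mono) auto
      then have "g\<^sup>2 * (c a)\<^sup>2 \<le> (\<mu> a + p)\<^sup>2 * (c a)\<^sup>2" by (intro mult_right_mono) auto
      moreover have "\<mu> a + p > 0" using \<mu>[OF that] g by simp
      ultimately have "g\<^sup>2 * (c a)\<^sup>2 / (\<mu> a + p)\<^sup>2 \<le> (c a)\<^sup>2"
        by (simp add: pos_divide_le_eq mult.commute)
      then show ?thesis by (simp add: power2_eq_square)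
    qed
    ultimately show ?thesis by (simp only: sum_distrib_left) (intro sum_mono, simp)
  qed
  then have "(g * L2_set x V)\<^sup>2 \<le> (L2_set y V)\<^sup>2" by (simp add: power_mult_distrib L2_set_power2)
  then have gx: "g * L2_set x V \<le> L2_set y V" by (rule power2_le_imp_le) simp
  have "L2_set z V \<le> M * L2_set x V"
  proof (cases "L2_set z V = 0")
    case True
    then show ?thesis using M_ge_0 by simp
  next
    case False
    then have "L2_set z V > 0" by (simp add: order_less_le)
    moreover have "L2_set z V * L2_set z V \<le> L2_set z V * (M * L2_set x V)"
      using zz by (simp add: power2_eq_square algebra_simps)
    ultimately show ?thesis by simp
  qed
  also have "\<dots> \<le> M * (L2_set y V / g)"
    using gx g M_ge_0 by (intro mult_left_mono) (auto simp: field_simps)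
  finally show ?thesis by (simp add: z_def e_def g_def)
qed

abbreviation Ph :: "(nat \<Rightarrow> real) \<Rightarrow> nat \<Rightarrow> real" where "Ph \<equiv> proj_on V {..<k} u"
abbreviation Pr :: "(nat \<Rightarrow> real) \<Rightarrow> nat \<Rightarrow> real" where "Pr \<equiv> proj_on V \<C> w"

lemma inner_indicator: "W \<subseteq> V \<Longrightarrow> inner_on V (indicator W) x = (\<Sum>i\<in>W. x i)"
  unfolding inner_on_def using finite_V by (intro sum.mono_neutral_cong_right) auto

text \<open>The squared Frobenius distance of two projections of rank \<open>k\<close> is
  \<open>2 * k\<close> minus twice the trace of their product. That trace sums the squared norms of
  the cluster projections of the \<open>u a\<close>, each at least \<open>1 - e^2\<close> by the
  residual bound.\<close>

lemma frobenius_bound: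
  "(\<Sum>j\<in>V. inner_on V (\<lambda>i. Ph (indicator {j}) i - Pr (indicator {j}) i)
        (\<lambda>i. Ph (indicator {j}) i - Pr (indicator {j}) i)) \<le> 2 * k * e\<^sup>2"
proof -
  have ind: "inner_on V (indicator {j}) x = x j" if "j \<in> V" for j x
    using inner_indicator[of "{j}" x] that by simp
  have "inner_on V (\<lambda>i. Ph (indicator {j}) i - Pr (indicator {j}) i)
        (\<lambda>i. Ph (indicator {j}) i - Pr (indicator {j}) i)
      = (\<Sum>a<k. u a j * u a j) - 2 * (\<Sum>a<k. \<Sum>C\<in>\<C>. u a j * w C j * inner_on V (u a) (w C))
        + (\<Sum>C\<in>\<C>. w C j * w C j)" if "j \<in> V" for j
  proof -
    have "inner_on V (Ph (indicator {j})) (Pr (indicator {j}))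
        = (\<Sum>a<k. u a j * inner_on V (Pr (indicator {j})) (u a))"
      by (simp add: inner_on_proj[of V "{..<k}"] ind[OF that])
    also have "\<dots> = (\<Sum>a<k. \<Sum>C\<in>\<C>. u a j * w C j * inner_on V (u a) (w C))"
      by (simp add: inner_on_proj ind[OF that] sum_distrib_left mult.assoc)
    finally have "inner_on V (Ph (indicator {j})) (Pr (indicator {j}))
        = (\<Sum>a<k. \<Sum>C\<in>\<C>. u a j * w C j * inner_on V (u a) (w C))" .
    moreover have "inner_on V (Pr (indicator {j})) (Ph (indicator {j}))
        = inner_on V (Ph (indicator {j})) (Pr (indicator {j}))" by (rule inner_on_commute)
    moreover have "inner_on V (Ph (indicator {j})) (Ph (indicator {j})) = (\<Sum>a<k. u a j * u a j)"
      using inner_on_proj_self[OF orthonormal_u, of "indicator {j}"]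
      by (simp add: ind[OF that] power2_eq_square)
    moreover have "inner_on V (Pr (indicator {j})) (Pr (indicator {j})) = (\<Sum>C\<in>\<C>. w C j * w C j)"
      using inner_on_proj_self[OF orthonormal_w finite_C, of "indicator {j}"]
      by (simp add: ind[OF that] power2_eq_square)
    ultimately show ?thesis unfolding inner_on_diff_left inner_on_diff_right by linarith
  qed
  then have "(\<Sum>j\<in>V. inner_on V (\<lambda>i. Ph (indicator {j}) i - Pr (indicator {j}) i)
        (\<lambda>i. Ph (indicator {j}) i - Pr (indicator {j}) i))
     = (\<Sum>j\<in>V. \<Sum>a<k. u a j * u a j)
      - 2 * (\<Sum>j\<in>V. \<Sum>a<k. \<Sum>C\<in>\<C>. u a j * w C j * inner_on V (u a) (w C))
        + (\<Sum>j\<in>V. \<Sum>C\<in>\<C>. w C j * w C j)"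
    by (simp add: sum.distrib sum_subtractf sum_distrib_left)
  also have "(\<Sum>j\<in>V. \<Sum>a<k. u a j * u a j) = (\<Sum>a<k. inner_on V (u a) (u a))"
    unfolding inner_on_def by (rule sum.swap)
  also have "\<dots> = k" using orthonormal_u by (simp add: orthonormal_on_def)
  also have "(\<Sum>j\<in>V. \<Sum>C\<in>\<C>. w C j * w C j) = (\<Sum>C\<in>\<C>. inner_on V (w C) (w C))"
    unfolding inner_on_def by (rule sum.swap)
  also have "\<dots> = k" using orthonormal_w by (simp add: orthonormal_on_def k_def)
  also have "(\<Sum>j\<in>V. \<Sum>a<k. \<Sum>C\<in>\<C>. u a j * w C j * inner_on V (u a) (w C))
      = (\<Sum>a<k. \<Sum>j\<in>V. \<Sum>C\<in>\<C>. u a j * w C j * inner_on V (u a) (w C))"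
    by (rule sum.swap)
  also have "\<dots> = (\<Sum>a<k. \<Sum>C\<in>\<C>. \<Sum>j\<in>V. u a j * w C j * inner_on V (u a) (w C))"
    by (intro sum.cong refl sum.swap)
  also have "\<dots> = (\<Sum>a<k. \<Sum>C\<in>\<C>. (inner_on V (u a) (w C))\<^sup>2)"
    by (simp add: inner_on_def sum_distrib_right power2_eq_square)
  finally have total: "(\<Sum>j\<in>V. inner_on V (\<lambda>i. Ph (indicator {j}) i - Pr (indicator {j}) i)
        (\<lambda>i. Ph (indicator {j}) i - Pr (indicator {j}) i))
     = 2 * (k - (\<Sum>a<k. \<Sum>C\<in>\<C>. (inner_on V (u a) (w C))\<^sup>2))" by simp
  have "1 - e\<^sup>2 \<le> (\<Sum>C\<in>\<C>. (inner_on V (u a) (w C))\<^sup>2)" if "a < k" for a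
  proof -
    have ua: "inner_on V (u a) (u a) = 1" using orthonormal_u that by (simp add: orthonormal_on_def)
    \<comment> \<open>Writes \<open>u a\<close> as a combination of the top eigenvectors, the form
      in which the residual bound is stated.\<close>
    have "u a = (\<lambda>i. \<Sum>b<k. (if b = a then 1 else 0) * u b i)"
      using that by (simp add: if_distribR if_distrib[of "\<lambda>x. x * _"] cong: if_cong)
    from residual_bound[OF this]
    have "(L2_set (\<lambda>i. u a i - Pr (u a) i) V)\<^sup>2 \<le> (e * L2_set (u a) V)\<^sup>2"
      by (intro power_mono) auto
    then show ?thesis
      by (simp add: power_mult_distrib L2_set_power2 inner_on_residual[OF orthonormal_w finite_C] ua)
  qed
  then have "(\<Sum>a<k. 1 - e\<^sup>2) \<le> (\<Sum>a<k. \<Sum>C\<in>\<C>. (inner_on V (u a) (w C))\<^sup>2)"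
    by (intro sum_mono) auto
  then show ?thesis unfolding total by (simp add: algebra_simps)
qed

text \<open>Averaging the Frobenius bound over the \<open>k * s\<close> columns.\<close>

lemma good_column_exists:
  obtains j where "j \<in> V"
    "inner_on V (\<lambda>i. Ph (indicator {j}) i - Pr (indicator {j}) i)
        (\<lambda>i. Ph (indicator {j}) i - Pr (indicator {j}) i) \<le> 2 * e\<^sup>2 / s"
proof -
  define d where "d = (\<lambda>j. inner_on V (\<lambda>i. Ph (indicator {j}) i - Pr (indicator {j}) i)
        (\<lambda>i. Ph (indicator {j}) i - Pr (indicator {j}) i))"
  have "\<exists>j\<in>V. d j \<le> 2 * e\<^sup>2 / s"
  proof (rule ccontr)
    assume "\<not> ?thesis"
    then have "(\<Sum>j\<in>V. 2 * e\<^sup>2 / s) < (\<Sum>j\<in>V. d j)"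
      using finite_V s_pos s_le_card_V by (intro sum_strict_mono) auto
    moreover have "(\<Sum>j\<in>V. 2 * e\<^sup>2 / s) = 2 * k * e\<^sup>2"
      using s_pos by (simp add: card_V)
    ultimately show False using frobenius_bound by (simp add: d_def)
  qed
  then show thesis using that by (auto simp: d_def)
qed

text \<open>Let \<open>a\<close> be the sum of the column \<open>y\<close> over its cluster.
  Closeness to the scaled indicator bounds the norm of \<open>y\<close> in terms of
  \<open>a\<close>; the choice of \<open>W\<close> makes the sum over \<open>W\<close> at least
  \<open>a\<close>. That sum is the inner product of \<open>y\<close> with the projected indicator
  of \<open>W\<close>, so Cauchy-Schwarz bounds the norm of the latter from below.\<close>

lemma good_column_norm:
  assumes P: "orthogonal_projection_on V (span_first k u) P" and j: "j \<in> V"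
    and close: "inner_on V (\<lambda>i. Ph (indicator {j}) i - Pr (indicator {j}) i)
        (\<lambda>i. Ph (indicator {j}) i - Pr (indicator {j}) i) \<le> 2 * e\<^sup>2 / s"
    and W: "top_column_set V P s j W" and e_small: "e \<le> 1 / 2"
  shows "(1 - 2 * e\<^sup>2) * s \<le> inner_on V (Ph (indicator W)) (Ph (indicator W))"
proof -
  define y where "y = Ph (indicator {j})"
  define t where "t = 1 - 2 * e\<^sup>2"
  note Wp = top_column_set_props[OF W finite_V j s_pos s_le_card_V]
  obtain C where C: "C \<in> \<C>" "j \<in> C" using j partition by (auto simp: partition_on_def)
  have Pr: "Pr (indicator {j}) i = 1 / s * indicator C i" if "i \<in> V" for i
  proof -
    have "Pr (indicator {j}) i = (\<Sum>D\<in>\<C>. if D = C then 1 / s * indicator C i else 0)"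
      unfolding proj_on_def
    proof (intro sum.cong refl)
      fix D assume D: "D \<in> \<C>"
      have "inner_on V (indicator {j}) (w D) = w D j" using inner_indicator[of "{j}"] j by simp
      then show "inner_on V (indicator {j}) (w D) * w D i = (if D = C then 1 / s * indicator C i else 0)"
      proof (cases "D = C")
        case True
        then show ?thesis using \<open>inner_on V (indicator {j}) (w D) = w D j\<close> C by (simp add: w_def)
      next
        case False
        then have "j \<notin> D" using cluster_unique[OF D C(1) _ C(2)] by blast
        then show ?thesis using False \<open>inner_on V (indicator {j}) (w D) = w D j\<close> by (simp add: w_def)
      qed
    qed
    then show ?thesis using C finite_C by simp
  qed
  define a where "a = inner_on V (indicator C) y"
  have yP: "y i = P i j" if "i \<in> V" for i
  proof -
    have "y i = mat_vec_on V P (indicator {j}) i"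
      unfolding y_def by (rule orthogonal_projection_on_span_first[OF orthonormal_u P that, symmetric])
    also have "\<dots> = (\<Sum>l\<in>V. if l = j then P i l else 0)"
      unfolding mat_vec_on_def by (intro sum.cong) (auto simp: indicator_def)
    finally show ?thesis using finite_V j by simp
  qed
  have CV: "C \<subseteq> V" using C cluster_subset by auto
  have "a = sum y C" unfolding a_def by (rule inner_indicator[OF CV])
  also have "\<dots> \<le> sum y W"
  proof (rule sum_le_sum_if_dominated)
    show "finite W" "finite C" using Wp CV finite_V by (auto intro: finite_subset)
    show "card W = card C" using Wp size C by simp
    \<comment> \<open>As \<open>j\<close> lies in both \<open>W\<close> and \<open>C\<close>, the
      exceptional element of \<open>W\<close> never takes part in the exchange.\<close>
    fix b d assume "b \<in> W - C" "d \<in> C - W"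
    then show "y d \<le> y b" using Wp(1,4) CV yP C by (metis DiffD1 DiffD2 DiffI subsetD)
  qed
  also have "\<dots> = inner_on V (indicator W) y" by (rule inner_indicator[OF Wp(1), symmetric])
  also have "\<dots> = inner_on V (Ph (indicator W)) y"
    using inner_on_proj_proj[OF orthonormal_u, of "indicator {j}" "indicator W"]
    by (simp add: y_def inner_on_commute)
  finally have aW: "a \<le> inner_on V (Ph (indicator W)) y" .
  have CC: "inner_on V (indicator C) (indicator C) = real s"
    using inner_indicator[OF CV, of "indicator C"] size[OF C(1)] by simp
  have "inner_on V y y - 2 * a / s + 1 / s \<le> 2 * e\<^sup>2 / s"
  proof -
    have "inner_on V (\<lambda>i. y i - 1 / s * indicator C i) (\<lambda>i. y i - 1 / s * indicator C i) \<le> 2 * e\<^sup>2 / s"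
      using close Pr unfolding y_def by (subst inner_on_cong[OF _ _]) (auto cong: inner_on_cong)
    then show ?thesis using s_pos CC
      by (simp only: inner_on_diff_left inner_on_diff_right inner_on_scale_left inner_on_scale_right
          a_def inner_on_commute[of V y "indicator C"]) (simp add: diff_divide_distrib)
  qed
  then have "inner_on V y y \<le> (2 * a - t) / s"
    by (simp add: t_def diff_divide_distrib)
  then have yy: "s * inner_on V y y \<le> 2 * a - t" using s_pos by (simp add: pos_le_divide_eq mult.commute)
  have t: "t \<ge> 1/2"
  proof -
    have "e\<^sup>2 \<le> (1/2)\<^sup>2" using e_small e_ge_0 by (intro power_mono) auto
    then show ?thesis by (simp add: t_def power2_eq_square)
  qed
  have "0 \<le> s * inner_on V y y" using inner_on_ge_0 by simp
  then have a_pos: "a > 0" using yy t by linarith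
  have ypos: "inner_on V y y > 0"
  proof (rule ccontr)
    assume "\<not> ?thesis"
    then have "inner_on V y y = 0" using inner_on_ge_0[of V y] by simp
    then have "\<forall>i\<in>V. y i = 0" using inner_on_eq_0[OF finite_V] by blast
    then have "a = 0" by (simp add: a_def inner_on_def)
    then show False using a_pos by simp
  qed
  \<comment> \<open>The factor \<open>t\<close> is chosen so that \<open>a\<close> drops out:
    \<open>t * (2 * a - t) <= a^2\<close> is a completed square.\<close>
  have "t * s * inner_on V y y \<le> t * (2 * a - t)"
    using mult_left_mono[OF yy, of t] t by (simp add: mult.assoc)
  also have "\<dots> \<le> a\<^sup>2" using zero_le_power2[of "a - t"] by (simp add: power2_eq_square algebra_simps)
  also have "\<dots> \<le> (inner_on V (Ph (indicator W)) y)\<^sup>2" using aW a_pos by (intro power_mono) auto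
  also have "\<dots> \<le> (L2_set (Ph (indicator W)) V * L2_set y V)\<^sup>2"
    using abs_inner_on_le[of V "Ph (indicator W)" y] by (subst abs_le_square_iff[symmetric]) simp
  also have "\<dots> = inner_on V (Ph (indicator W)) (Ph (indicator W)) * inner_on V y y"
    by (simp add: power_mult_distrib L2_set_power2)
  finally show ?thesis using ypos by (simp add: t_def)
qed

text \<open>Replacing \<open>y\<close> by its cluster projection costs at most
  \<open>e * sqrt s\<close> after division by the norm of \<open>y\<close>, so the cluster
  projection of the indicator of \<open>W\<close> has norm at least
  \<open>(1 - 2 * e) * sqrt s\<close>. Its square is the sum of
  \<open>card (W \<inter> C)^2 / s\<close>.\<close>

lemma overlap_from_norm:
  assumes W: "W \<subseteq> V" "card W = s" and e_small: "e \<le> 1 / 2"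
    and norm: "(1 - 2 * e\<^sup>2) * s \<le> inner_on V (Ph (indicator W)) (Ph (indicator W))"
  shows "\<exists>C\<in>\<C>. (1 - 4 * e) * s \<le> card (W \<inter> C)"
proof -
  define y where "y = Ph (indicator W)"
  define t where "t = 1 - 2 * e\<^sup>2"
  have e2: "2 * e\<^sup>2 \<le> e" using mult_right_mono[OF e_small e_ge_0] unfolding power2_eq_square by linarith
  then have t: "1 - e \<le> t" "t \<le> 1" by (auto simp: t_def)
  \<comment> \<open>For \<open>e <= 1/2\<close> one has
    \<open>(1 - e)^2 <= 1 - e <= 1 - 2 * e^2\<close>, which avoids square roots of
    \<open>t\<close>.\<close>
  have ynorm: "(1 - e) * sqrt s \<le> L2_set y V"
  proof (rule power2_le_imp_le)
    have "(1 - e)\<^sup>2 \<le> 1 - e" using e_small e_ge_0 by (simp add: power2_eq_square mult_left_le)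
    then have "((1 - e) * sqrt s)\<^sup>2 \<le> t * s"
      using t by (simp add: power_mult_distrib mult_right_mono)
    then show "((1 - e) * sqrt s)\<^sup>2 \<le> (L2_set y V)\<^sup>2"
      using norm by (simp add: L2_set_power2 y_def t_def)
  qed simp
  have ypos: "L2_set y V > 0"
  proof -
    have "0 < (1 - e) * sqrt s" using e_small s_pos by simp
    then show ?thesis using ynorm by linarith
  qed
  have indW: "L2_set (indicator W) V = sqrt s"
    unfolding L2_set_eq_sqrt using inner_indicator[OF W(1), of "indicator W"] W by simp
  have "(L2_set y V)\<^sup>2 = inner_on V (indicator W) y"
    using inner_on_proj_proj[OF orthonormal_u, of "indicator W" "indicator W"]
    by (simp add: L2_set_power2 y_def inner_on_commute)
  also have "\<dots> = inner_on V (indicator W) (Pr y) + inner_on V (indicator W) (\<lambda>i. y i - Pr y i)"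
    by (simp add: inner_on_diff_right)
  also have "inner_on V (indicator W) (Pr y) = inner_on V (Pr (indicator W)) y"
    by (subst inner_on_commute) (simp add: inner_on_proj mult.commute)
  also have "\<dots> \<le> L2_set (Pr (indicator W)) V * L2_set y V"
    using abs_inner_on_le[of V "Pr (indicator W)" y] by linarith
  also have "inner_on V (indicator W) (\<lambda>i. y i - Pr y i) \<le> sqrt s * (e * L2_set y V)"
  proof -
    have "inner_on V (indicator W) (\<lambda>i. y i - Pr y i) \<le> sqrt s * L2_set (\<lambda>i. y i - Pr y i) V"
      using abs_inner_on_le[of V "indicator W" "\<lambda>i. y i - Pr y i"] indW by simp
    also have "\<dots> \<le> sqrt s * (e * L2_set y V)"
      by (intro mult_left_mono residual_bound[of y "\<lambda>a. inner_on V (indicator W) (u a)"])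
        (auto simp: y_def proj_on_def)
    finally show ?thesis .
  qed
  finally have "L2_set y V * L2_set y V \<le> (L2_set (Pr (indicator W)) V + sqrt s * e) * L2_set y V"
    by (simp add: power2_eq_square algebra_simps)
  then have "L2_set y V \<le> L2_set (Pr (indicator W)) V + sqrt s * e" using ypos by simp
  then have "(1 - 2 * e) * sqrt s \<le> L2_set (Pr (indicator W)) V"
    using ynorm by (simp add: algebra_simps)
  then have "((1 - 2 * e) * sqrt s)\<^sup>2 \<le> (L2_set (Pr (indicator W)) V)\<^sup>2"
    using e_small by (intro power_mono) auto
  then have lower: "(1 - 2 * e)\<^sup>2 * s \<le> (\<Sum>C\<in>\<C>. (inner_on V (indicator W) (w C))\<^sup>2)"
    by (simp add: power_mult_distrib L2_set_power2 inner_on_proj_self[OF orthonormal_w finite_C])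
  have ind_sum: "(\<Sum>i\<in>C. indicator W i :: real) = card (W \<inter> C)" if "C \<in> \<C>" for C
    using cluster_subset[OF that] finite_V
    by (simp add: indicator_def sum.inter_restrict[symmetric] finite_subset Int_commute)
  then have iw: "inner_on V (indicator W) (w C) = card (W \<inter> C) / sqrt s" if "C \<in> \<C>" for C
    using that by (simp add: inner_w)
  obtain C where C: "C \<in> \<C>" "\<And>D. D \<in> \<C> \<Longrightarrow> card (W \<inter> D) \<le> card (W \<inter> C)"
  proof -
    have "Max ((\<lambda>D. card (W \<inter> D)) ` \<C>) \<in> (\<lambda>D. card (W \<inter> D)) ` \<C>"
      using finite_C nonempty by (intro Max_in) auto
    then obtain C where "C \<in> \<C>" "card (W \<inter> C) = Max ((\<lambda>D. card (W \<inter> D)) ` \<C>)" by auto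
    then show thesis using finite_C by (intro that[of C]) auto
  qed
  have "(\<Sum>D\<in>\<C>. (inner_on V (indicator W) (w D))\<^sup>2) = (\<Sum>D\<in>\<C>. real (card (W \<inter> D)) * card (W \<inter> D) / s)"
    by (intro sum.cong refl) (simp add: iw power_divide power2_eq_square)
  \<comment> \<open>The overlaps sum to \<open>s\<close>, so the sum of their squares divided by
    \<open>s\<close> is at most the largest overlap.\<close>
  also have "\<dots> \<le> (\<Sum>D\<in>\<C>. real (card (W \<inter> C)) * card (W \<inter> D) / s)"
    using C by (intro sum_mono divide_right_mono mult_right_mono) auto
  also have "\<dots> = real (card (W \<inter> C)) / s * (\<Sum>D\<in>\<C>. real (card (W \<inter> D)))"
    by (simp add: sum_distrib_left)
  also have "(\<Sum>D\<in>\<C>. real (card (W \<inter> D))) = s"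
  proof -
    have "(\<Sum>i\<in>V. indicator W i :: real) = (\<Sum>D\<in>\<C>. \<Sum>i\<in>D. indicator W i)" by (rule sum_clusters)
    also have "\<dots> = (\<Sum>D\<in>\<C>. real (card (W \<inter> D)))"
      by (intro sum.cong refl ind_sum)
    also have "(\<Sum>i\<in>V. indicator W i :: real) = card W"
      using W finite_V by (simp add: indicator_def sum.inter_restrict[symmetric] inf.absorb2)
    finally show ?thesis using W by simp
  qed
  finally have "(1 - 2 * e)\<^sup>2 * s \<le> card (W \<inter> C)" using lower s_pos by simp
  moreover have "1 - 4 * e \<le> (1 - 2 * e)\<^sup>2" by (simp add: power2_eq_square algebra_simps)
  then have "(1 - 4 * e) * s \<le> (1 - 2 * e)\<^sup>2 * s" by (intro mult_right_mono) auto
  ultimately show ?thesis using C by (intro bexI[of _ C]) auto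
qed

end

text \<open>The maximiser \<open>j\<close> itself may be a bad column. It only inherits the norm
  bound from the good column \<open>i\<close>, and the norm alone forces a large overlap.\<close>

theorem overlap:
  assumes P: "top_projection V A (card \<C>) P"
    and W: "\<forall>j\<in>V. top_column_set V P s j (W j)"
    and j: "j \<in> V"
    and max: "\<forall>i\<in>V. L2_set (mat_vec_on V P (indicator (W i))) V
                  \<le> L2_set (mat_vec_on V P (indicator (W j))) V"
    and e_small: "e \<le> 1 / 2"
  shows "\<exists>C\<in>\<C>. (1 - 4 * e) * s \<le> card (W j \<inter> C)"
proof -
  obtain u \<mu> where u: "ordered_eigenbasis V A u \<mu>"
    and P: "orthogonal_projection_on V (span_first k u) P"
    using P unfolding top_projection_def k_def by blast
  have norm: "L2_set (mat_vec_on V P x) V = L2_set (proj_on V {..<k} u x) V" for x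
    by (intro L2_set_cong refl orthogonal_projection_on_span_first[OF orthonormal_u[OF u] P])
  obtain i where i: "i \<in> V"
    "inner_on V (\<lambda>l. proj_on V {..<k} u (indicator {i}) l - proj_on V \<C> w (indicator {i}) l)
      (\<lambda>l. proj_on V {..<k} u (indicator {i}) l - proj_on V \<C> w (indicator {i}) l) \<le> 2 * e\<^sup>2 / s"
    using good_column_exists[OF u] by blast
  have "(1 - 2 * e\<^sup>2) * s \<le> (L2_set (proj_on V {..<k} u (indicator (W i))) V)\<^sup>2"
    unfolding L2_set_power2 by (rule good_column_norm[OF u P i(1) i(2)]) (use W i e_small in auto)
  also have "\<dots> \<le> (L2_set (proj_on V {..<k} u (indicator (W j))) V)\<^sup>2"
    using max i norm by (intro power_mono) auto
  finally show ?thesis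
    using top_column_set_props[OF _ finite_V j s_pos s_le_card_V, of P "W j"] W j e_small
    by (intro overlap_from_norm[OF u]) (auto simp: L2_set_power2)
qed

end

section \<open>Runs of the algorithm on a typical graph\<close>

text \<open>Strict separation rules out ties: a different set of the same size contains a vertex
  outside \<open>C\<close> and omits one of \<open>C\<close>. As an equivalence it serves both
  correctness and existence of runs.\<close>

lemma most_neighbors_unique:
  assumes "finite V" "C \<subseteq> V" "card C = s"
    and sep: "\<And>v w. v \<in> C \<Longrightarrow> w \<in> V - C \<Longrightarrow> num_neighbors_in E W w < num_neighbors_in E W v"
  shows "most_neighbors V E s W C' \<longleftrightarrow> C' = C"
proof
  assume C': "most_neighbors V E s W C'"
  show "C' = C"
  proof (rule ccontr)
    assume neq: "C' \<noteq> C"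
    have fin: "finite C" "finite C'" "card C' = card C" "C' \<subseteq> V"
      using assms C' by (auto simp: most_neighbors_def intro: finite_subset)
    have "\<not> C' \<subseteq> C" using fin neq card_subset_eq by blast
    moreover have "\<not> C \<subseteq> C'" using fin neq card_subset_eq by metis
    ultimately obtain v w where "v \<in> C' - C" "w \<in> C - C'" by blast
    then show False
      using sep[of w v] C' fin assms unfolding most_neighbors_def by (meson Diff_iff in_mono not_le)
  qed
next
  assume "C' = C"
  then show "most_neighbors V E s W C'"
    using assms by (auto simp: most_neighbors_def intro: less_imp_le)
qed

text \<open>Since \<open>W\<close> depends on \<open>E\<close>, its neighbour counts are not
  controlled directly but compared with those of a fixed cluster. It is also used with the roles of
  \<open>W\<close> and \<open>C\<close> exchanged.\<close>

lemma num_neighbors_in_le: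
  assumes "finite W" "finite C"
  shows "num_neighbors_in E C v \<le> num_neighbors_in E W v + card (C - W)"
proof -
  have "num_neighbors_in E C v \<le> card ({w \<in> W. {v, w} \<in> E} \<union> (C - W))"
    unfolding num_neighbors_in_def using assms by (intro card_mono) auto
  also have "\<dots> \<le> num_neighbors_in E W v + card (C - W)"
    unfolding num_neighbors_in_def by (rule card_Un_le)
  finally show ?thesis .
qed

section \<open>Typical graphs: deterministic conditions on noise and degrees\<close>

definition mean_adjacency :: "nat set set \<Rightarrow> real \<Rightarrow> real \<Rightarrow> nat \<Rightarrow> nat \<Rightarrow> real" where
  "mean_adjacency \<C> p q i j =
     (if i = j then 0 else if \<exists>C\<in>\<C>. i \<in> C \<and> j \<in> C then p else q)"

definition noise_matrix :: "nat set set \<Rightarrow> nat set set \<Rightarrow> real \<Rightarrow> real \<Rightarrow> nat \<Rightarrow> nat \<Rightarrow> real" where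
  "noise_matrix E \<C> p q i j = adjacency E i j - mean_adjacency \<C> p q i j"

text \<open>Extension by zero preserves the norms and the form, so one bound on the full vertex set
  serves every round.\<close>

lemma form_bound_subset:
  assumes "finite V0" "V \<subseteq> V0"
    and "\<And>x y. \<bar>inner_on V0 x (mat_vec_on V0 X y)\<bar> \<le> M * L2_set x V0 * L2_set y V0"
  shows "\<bar>inner_on V x (mat_vec_on V X y)\<bar> \<le> M * L2_set x V * L2_set y V"
proof -
  define r where "r = (\<lambda>x i. if i \<in> V then x i else (0::real))"
  have sum_r: "(\<Sum>i\<in>V0. if i \<in> V then f i else 0) = sum f V" for f :: "nat \<Rightarrow> real"
    using assms(1,2) by (simp add: sum.inter_restrict[symmetric] inf.absorb2)
  have "L2_set (r z) V0 = L2_set z V" for z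
  proof -
    have "(\<Sum>i\<in>V0. (r z i)\<^sup>2) = (\<Sum>i\<in>V0. if i \<in> V then (z i)\<^sup>2 else 0)"
      by (intro sum.cong) (auto simp: r_def)
    then show ?thesis by (simp add: L2_set_def sum_r)
  qed
  moreover have "inner_on V0 (r x) (mat_vec_on V0 X (r y)) = inner_on V x (mat_vec_on V X y)"
  proof -
    have mv: "mat_vec_on V0 X (r y) i = mat_vec_on V X y i" for i
    proof -
      have "(\<Sum>j\<in>V0. X i j * r y j) = (\<Sum>j\<in>V0. if j \<in> V then X i j * y j else 0)"
        by (intro sum.cong) (auto simp: r_def)
      then show ?thesis by (simp add: mat_vec_on_def sum_r)
    qed
    have "(\<Sum>i\<in>V0. r x i * mat_vec_on V X y i) = (\<Sum>i\<in>V0. if i \<in> V then x i * mat_vec_on V X y i else 0)"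
      by (intro sum.cong) (auto simp: r_def)
    then show ?thesis by (simp add: inner_on_def mv sum_r)
  qed
  ultimately show ?thesis using assms(3)[of "r x" "r y"] by simp
qed

text \<open>All that the algorithm's success needs from the random graph. Degrees are controlled
  only into whole clusters, which stay intact until they are removed. The condition
  \<open>large\<close> absorbs the missing loop in the mean degree
  \<open>p * (s - 1)\<close>.\<close>

locale typical_graph =
  fixes V0 :: "nat set" and \<C> :: "nat set set" and s :: nat and p q M :: real and E :: "nat set set"
  assumes finite_V0: "finite V0" and partition0: "partition_on V0 \<C>"
    and size0: "\<And>C. C \<in> \<C> \<Longrightarrow> card C = s"
    and q0: "0 \<le> q" and p1: "p \<le> 1"
    and E_subset: "E \<subseteq> all_edges V0"
    and noise0: "\<And>x y. \<bar>inner_on V0 x (mat_vec_on V0 (noise_matrix E \<C> p q) y)\<bar>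
        \<le> M * L2_set x V0 * L2_set y V0"
    and M0: "0 \<le> M" and gap0: "M < (p - q) * s" and large: "4 < (p - q) * s"
    and ratio: "M / ((p - q) * s - M) \<le> (p - q) / 16"
    and degrees: "\<And>C v. C \<in> \<C> \<Longrightarrow> v \<in> V0 \<Longrightarrow>
      \<bar>real (num_neighbors_in E C v) - (\<Sum>j\<in>C. mean_adjacency \<C> p q v j)\<bar> \<le> (p - q) * s / 8"
begin

lemma s_pos0: "0 < s"
  using large by (cases s) auto

lemma cluster_unique0: "C \<in> \<C> \<Longrightarrow> D \<in> \<C> \<Longrightarrow> i \<in> C \<Longrightarrow> i \<in> D \<Longrightarrow> C = D"
  using partition0 unfolding partition_on_def disjoint_def by blast

lemma mean_degree_inside:
  assumes "C \<in> \<C>" "v \<in> C"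
  shows "(\<Sum>j\<in>C. mean_adjacency \<C> p q v j) = p * (real s - 1)"
proof -
  have fin: "finite C" using size0[OF assms(1)] s_pos0 card_gt_0_iff by fastforce
  have "(\<Sum>j\<in>C. mean_adjacency \<C> p q v j) = (\<Sum>j\<in>C. if j = v then 0 else p)"
    using assms by (intro sum.cong) (auto simp: mean_adjacency_def)
  also have "\<dots> = (\<Sum>j\<in>C - {v}. p)"
    using fin by (intro sum.mono_neutral_cong_right) auto
  finally show ?thesis using assms size0 s_pos0 fin by (simp add: of_nat_diff)
qed

lemma mean_degree_outside:
  assumes "C \<in> \<C>" "v \<notin> C"
  shows "(\<Sum>j\<in>C. mean_adjacency \<C> p q v j) = q * s"
proof -
  have "(\<Sum>j\<in>C. mean_adjacency \<C> p q v j) = (\<Sum>j\<in>C. q)"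
    using assms cluster_unique0[OF assms(1)] by (intro sum.cong) (auto simp: mean_adjacency_def)
  then show ?thesis using size0[OF assms(1)] by simp
qed

text \<open>Inside the cluster at least \<open>p * (s - 1)\<close> neighbours are expected, outside
  \<open>q * s\<close>. Each side loses an eighth of \<open>(p - q) * s\<close> to deviation and a
  quarter to the mismatch of \<open>W\<close> and \<open>C\<close>; the remaining
  \<open>(p - q) * s / 4 - p\<close> is positive.\<close>

lemma neighbors_separate:
  assumes C: "C \<in> \<C>" and W: "finite W" "card W = s" "(1 - (p - q) / 4) * s \<le> card (W \<inter> C)"
    and v: "v \<in> C" and x: "x \<in> V0 - C"
  shows "num_neighbors_in E W x < num_neighbors_in E W v"
proof -
  have fin: "finite C" using size0[OF C] s_pos0 card_gt_0_iff by fastforce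
  have "card (C - W) + card (W \<inter> C) = s" "card (W - C) + card (W \<inter> C) = s"
    using W fin size0[OF C] card_Int_Diff[of C W] card_Int_Diff[of W C] by (simp_all add: Int_commute)
  then have "real (card (C - W)) + card (W \<inter> C) = s" "real (card (W - C)) + card (W \<inter> C) = s"
    by linarith+
  then have miss: "card (C - W) \<le> (p - q) * s / 4" "card (W - C) \<le> (p - q) * s / 4"
    using W(3) by (simp_all add: field_simps)
  have vV: "v \<in> V0" using C v partition0 by (auto simp: partition_on_def)
  have "p * (real s - 1) - (p - q) * s / 8 \<le> num_neighbors_in E C v"
    using degrees[OF C vV] mean_degree_inside[OF C v] by linarith
  also have "\<dots> \<le> num_neighbors_in E W v + (p - q) * s / 4"
    using num_neighbors_in_le[OF W(1) fin, of E v] miss by linarith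
  finally have lower: "p * (real s - 1) - (p - q) * s / 8 - (p - q) * s / 4 \<le> num_neighbors_in E W v"
    by linarith
  have "num_neighbors_in E W x \<le> num_neighbors_in E C x + (p - q) * s / 4"
    using num_neighbors_in_le[OF fin W(1), of E x] miss by linarith
  also have "\<dots> \<le> q * s + (p - q) * s / 8 + (p - q) * s / 4"
  proof -
    have "\<bar>real (num_neighbors_in E C x) - q * s\<bar> \<le> (p - q) * s / 8"
      using degrees[OF C, of x] x mean_degree_outside[OF C, of x] by simp
    then show ?thesis by linarith
  qed
  finally have "real (num_neighbors_in E W x) < num_neighbors_in E W v"
    using lower large p1 by (simp add: field_simps)
  then show ?thesis by simp
qed

text \<open>As clusters stay whole, sharing one of the remaining clusters and sharing one of the
  original ones agree on the remaining vertices, so the noise matrix of the full graph is kept. On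
  the diagonal, \<open>p\<close>, the correction and a zero noise entry add up to 0.\<close>

lemma perturbed_clusters_subset:
  assumes "\<D> \<subseteq> \<C>" "\<D> \<noteq> {}"
  shows "perturbed_clusters (\<Union>\<D>) \<D> s p q M (adjacency (induced_edges E (\<Union>\<D>))) (noise_matrix E \<C> p q)"
proof
  have sub: "\<Union>\<D> \<subseteq> V0" using assms partition0 by (auto simp: partition_on_def)
  then show "finite (\<Union>\<D>)" using finite_V0 finite_subset by blast
  show "partition_on (\<Union>\<D>) \<D>"
  proof -
    have "disjoint \<D>" using assms(1) partition0 by (meson pairwise_subset partition_on_def)
    moreover have "{} \<notin> \<D>" using assms(1) partition0 by (auto simp: partition_on_def)
    ultimately show ?thesis by (simp add: partition_on_def)
  qed
  show "card C = s" if "C \<in> \<D>" for C using that assms(1) by (intro size0) auto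
  show "0 < s" by (rule s_pos0)
  show "0 \<le> q" by (rule q0)
  show "\<D> \<noteq> {}" by fact
  show "0 \<le> M" "M < (p - q) * s" by (rule M0 gap0)+
  show "\<bar>inner_on (\<Union>\<D>) x (mat_vec_on (\<Union>\<D>) (noise_matrix E \<C> p q) y)\<bar>
      \<le> M * L2_set x (\<Union>\<D>) * L2_set y (\<Union>\<D>)" for x y
    by (rule form_bound_subset[OF finite_V0 sub noise0])
  fix i j assume ij: "i \<in> \<Union>\<D>" "j \<in> \<Union>\<D>"
  have "{i} \<notin> E" using E_subset by (auto simp: all_edges_def)
  moreover have "(\<exists>C\<in>\<D>. i \<in> C \<and> j \<in> C) \<longleftrightarrow> (\<exists>C\<in>\<C>. i \<in> C \<and> j \<in> C)"
    using ij assms cluster_unique0 by blast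
  moreover have "\<exists>C\<in>\<D>. i \<in> C" using ij by blast
  ultimately show "adjacency (induced_edges E (\<Union>\<D>)) i j =
       (if \<exists>C\<in>\<D>. i \<in> C \<and> j \<in> C then p else q) - (if i = j then p else 0) + noise_matrix E \<C> p q i j"
    using ij by (auto simp: adjacency_def induced_edges_def noise_matrix_def mean_adjacency_def)
qed

lemma step_finds_cluster:
  assumes D: "\<D> \<subseteq> \<C>" "\<D> \<noteq> {}"
    and E': "E' = induced_edges E (\<Union>\<D>)"
    and P: "top_projection (\<Union>\<D>) (adjacency E') (card \<D>) P"
    and W: "\<forall>j\<in>\<Union>\<D>. top_column_set (\<Union>\<D>) P s j (W j)"
    and j: "j \<in> \<Union>\<D>"
    and max: "\<forall>i\<in>\<Union>\<D>. L2_set (mat_vec_on (\<Union>\<D>) P (indicator (W i))) (\<Union>\<D>)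
                  \<le> L2_set (mat_vec_on (\<Union>\<D>) P (indicator (W j))) (\<Union>\<D>)"
  shows "\<exists>C\<in>\<D>. \<forall>C'. most_neighbors (\<Union>\<D>) E' s (W j) C' \<longleftrightarrow> C' = C"
proof -
  interpret perturbed_clusters "\<Union>\<D>" \<D> s p q M "adjacency E'" "noise_matrix E \<C> p q"
    unfolding E' by (rule perturbed_clusters_subset[OF D])
  have e: "e \<le> (p - q) / 16" unfolding e_def by (rule ratio)
  then have "e \<le> 1 / 2" using p1 q0 by (simp add: field_simps)
  from overlap[OF P W j max this] obtain C where
    C: "C \<in> \<D>" "(1 - 4 * e) * s \<le> card (W j \<inter> C)" by blast
  have "1 - (p - q) / 4 \<le> 1 - 4 * e" using e by (simp add: field_simps)
  then have "(1 - (p - q) / 4) * s \<le> (1 - 4 * e) * s" by (intro mult_right_mono) auto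
  with C have overlap: "(1 - (p - q) / 4) * s \<le> card (W j \<inter> C)" by linarith
  note Wp = top_column_set_props[OF bspec[OF W j] finite_V j s_pos s_le_card_V]
  have num: "num_neighbors_in E' (W j) x = num_neighbors_in E (W j) x" if "x \<in> \<Union>\<D>" for x
  proof -
    have "{y \<in> W j. {x, y} \<in> E'} = {y \<in> W j. {x, y} \<in> E}"
      using that Wp(1) by (auto simp: E' induced_edges_def)
    then show ?thesis by (simp add: num_neighbors_in_def)
  qed
  have "most_neighbors (\<Union>\<D>) E' s (W j) C' \<longleftrightarrow> C' = C" for C'
  proof (rule most_neighbors_unique)
    show "finite (\<Union>\<D>)" by (rule finite_V)
    show CD: "C \<subseteq> \<Union>\<D>" using C by blast
    show "card C = s" using C size by blast
    fix v x assume vx: "v \<in> C" "x \<in> \<Union>\<D> - C"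
    have "num_neighbors_in E (W j) x < num_neighbors_in E (W j) v"
    proof (rule neighbors_separate)
      show "C \<in> \<C>" using C D by blast
      show "finite (W j)" using Wp finite_V finite_subset by blast
      show "card (W j) = s" by (rule Wp)
      show "x \<in> V0 - C" using vx D partition0 by (auto simp: partition_on_def)
    qed (use vx overlap in auto)
    then show "num_neighbors_in E' (W j) x < num_neighbors_in E' (W j) v"
      using num[of v] num[of x] vx CD by (auto simp only: subset_iff Diff_iff)
  qed
  then show ?thesis using C by blast
qed

text \<open>Each state of a run is a union of original clusters with its induced graph, and any
  choice among ties leads to another such state. Strong induction on their number proves both
  directions together, since a run is extended by a run for the remaining clusters.\<close>

lemma identify_clusters_subset:
  assumes "\<D> \<subseteq> \<C>"
  shows "identify_clusters s (\<Union>\<D>) (induced_edges E (\<Union>\<D>)) R \<longleftrightarrow> R = \<D>"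
  using assms
proof (induction "card \<D>" arbitrary: \<D> R rule: less_induct)
  case less
  show ?case
  proof (cases "\<D> = {}")
    case True
    have "identify_clusters s {} (induced_edges E {}) R \<longleftrightarrow> R = {}"
      by (subst identify_clusters.simps) auto
    then show ?thesis using True by simp
  next
    case False
    define V where "V = \<Union>\<D>"
    define E' where "E' = induced_edges E V"
    interpret perturbed_clusters V \<D> s p q M "adjacency E'" "noise_matrix E \<C> p q"
      unfolding E'_def V_def by (rule perturbed_clusters_subset[OF less.prems False])
    have div: "card V div s = card \<D>" "card \<D> \<ge> 1"
      using card_V s_pos k_pos by (simp_all add: k_def)
    have rec: "identify_clusters s (V - C) (induced_edges E' (V - C)) R' \<longleftrightarrow> R' = \<D> - {C}"
      if "C \<in> \<D>" for C R'
    proof -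
      have "V - C = \<Union>(\<D> - {C})"
        unfolding V_def using that less.prems cluster_unique0 by blast
      moreover have "induced_edges E' (V - C) = induced_edges E (V - C)"
        by (auto simp: E'_def induced_edges_def)
      moreover have "card (\<D> - {C}) < card \<D>" using finite_C that by (intro psubset_card_mono) auto
      ultimately show ?thesis using less.hyps[of "\<D> - {C}" R'] less.prems by auto
    qed
    note step = step_finds_cluster[OF less.prems False, folded V_def, OF E'_def]
    show ?thesis unfolding V_def[symmetric] E'_def[symmetric]
    proof
      assume "identify_clusters s V E' R"
      then show "R = \<D>"
      proof cases
        case stop
        then show ?thesis using div by simp
      next
        case (step k P W j C R')
        obtain C0 where C0: "C0 \<in> \<D>" "\<And>C'. most_neighbors V E' s (W j) C' \<longleftrightarrow> C' = C0"
          using step_finds_cluster[OF less.prems False, folded V_def, OF E'_def, of P W j] step div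
          by auto
        then have "C = C0" using step by blast
        then show ?thesis using rec[OF C0(1)] step C0 by auto
      qed
    next
      assume R: "R = \<D>"
      have "symmetric_on V (adjacency E')"
        by (simp add: symmetric_on_def adjacency_def insert_commute)
      then obtain P where P: "top_projection V (adjacency E') (card \<D>) P"
        using top_projection_exists[OF finite_V, of "adjacency E'" "card \<D>"] k_le_card_V
        by (auto simp: k_def)
      obtain W where W: "\<forall>j\<in>V. top_column_set V P s j (W j)"
        using top_column_set_exists[OF finite_V, of P s] by metis
      define f where "f = (\<lambda>j. L2_set (mat_vec_on V P (indicator (W j))) V)"
      have "V \<noteq> {}" using s_le_card_V s_pos by auto
      \<comment> \<open>Builds one concrete run; any maximiser will do.\<close>
      then have "Max (f ` V) \<in> f ` V" using finite_V by (intro Max_in) auto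
      then obtain j where j: "j \<in> V" "f j = Max (f ` V)" by auto
      have max: "\<forall>i\<in>V. f i \<le> f j" using j finite_V by auto
      obtain C where C: "C \<in> \<D>" "\<And>C'. most_neighbors V E' s (W j) C' \<longleftrightarrow> C' = C"
        using step[OF P W j(1)] max unfolding f_def by blast
      have "identify_clusters s V E' (insert C (\<D> - {C}))"
      proof (rule identify_clusters.step)
        show "card \<D> = card V div s" "1 \<le> card \<D>" using div by simp_all
        show "most_neighbors V E' s (W j) C" using C by blast
        show "identify_clusters s (V - C) (induced_edges E' (V - C)) (\<D> - {C})"
          using rec[OF C(1)] by blast
      qed (use P W j max in \<open>auto simp: f_def\<close>)
      then show "identify_clusters s V E' R" using C R by (simp add: insert_absorb)
    qed
  qed
qed

theorem identify_clusters_iff: "identify_clusters s V0 E R \<longleftrightarrow> R = \<C>"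
proof -
  have "\<Union>\<C> = V0" using partition0 by (auto simp: partition_on_def)
  moreover have "induced_edges E V0 = E"
    using E_subset by (auto simp: induced_edges_def all_edges_def)
  ultimately show ?thesis using identify_clusters_subset[of \<C> R] by simp
qed

end

section \<open>Bounding quadratic forms on a lattice\<close>

text \<open>Polarisation is applied to \<open>b * x\<close> and \<open>a * y\<close>, which both
  have norm \<open>a * b\<close>. With the parallelogram law no constant is lost.\<close>

lemma symmetric_form_bound_polarization:
  assumes "finite V" "symmetric_on V X" "0 \<le> m"
    and quad: "\<And>x. \<bar>inner_on V x (mat_vec_on V X x)\<bar> \<le> m * inner_on V x x"
  shows "\<bar>inner_on V x (mat_vec_on V X y)\<bar> \<le> m * L2_set x V * L2_set y V"
proof (cases "L2_set x V = 0 \<or> L2_set y V = 0")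
  case True
  then have "(\<forall>i\<in>V. x i = 0) \<or> (\<forall>i\<in>V. y i = 0)"
    using assms(1) by (simp add: L2_set_eq_0_iff)
  then have "inner_on V x (mat_vec_on V X y) = 0"
    by (auto simp: inner_on_def mat_vec_on_def)
  then show ?thesis using assms(3) by simp
next
  case False
  define a where "a = L2_set x V"
  define b where "b = L2_set y V"
  have ab: "a > 0" "b > 0" using False by (auto simp: a_def b_def order_less_le)
  define Q where "Q = (\<lambda>x. inner_on V x (mat_vec_on V X x))"
  define B where "B = inner_on V x (mat_vec_on V X y)"
  have "inner_on V y (mat_vec_on V X x) = B"
    unfolding B_def inner_on_mat_vec_symmetric[OF assms(2), of y x] by (rule inner_on_commute)
  then have pol: "4 * (a * b) * B = Q (\<lambda>i. b * x i + a * y i) - Q (\<lambda>i. b * x i - a * y i)"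
    unfolding Q_def mat_vec_on_add mat_vec_on_diff mat_vec_on_scale inner_on_add_left
      inner_on_add_right inner_on_diff_left inner_on_diff_right inner_on_scale_left
      inner_on_scale_right B_def[symmetric]
    by (simp add: algebra_simps)
  have "4 * (a * b) * \<bar>B\<bar> = \<bar>4 * (a * b) * B\<bar>" using ab by (simp add: abs_mult)
  also have "\<dots> \<le> \<bar>Q (\<lambda>i. b * x i + a * y i)\<bar> + \<bar>Q (\<lambda>i. b * x i - a * y i)\<bar>"
    unfolding pol by (rule abs_triangle_ineq4)
  also have "\<dots> \<le> m * inner_on V (\<lambda>i. b * x i + a * y i) (\<lambda>i. b * x i + a * y i)
      + m * inner_on V (\<lambda>i. b * x i - a * y i) (\<lambda>i. b * x i - a * y i)"
    unfolding Q_def by (intro add_mono quad)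
  also have "\<dots> = m * (2 * (b\<^sup>2 * inner_on V x x) + 2 * (a\<^sup>2 * inner_on V y y))"
    unfolding inner_on_add_left inner_on_add_right inner_on_diff_left inner_on_diff_right
      inner_on_scale_left inner_on_scale_right
    by (simp add: algebra_simps power2_eq_square)
  also have "\<dots> = 4 * (a * b) * (m * a * b)"
    unfolding L2_set_power2[symmetric] a_def[symmetric] b_def[symmetric]
    by (simp add: algebra_simps power2_eq_square)
  finally have "\<bar>B\<bar> \<le> m * a * b" using ab by simp
  then show ?thesis by (simp add: a_def b_def B_def)
qed

lemma abs_le_1_if_inner_le_1:
  assumes "finite V" "inner_on V x x \<le> 1" "i \<in> V"
  shows "\<bar>x i\<bar> \<le> 1"
proof -
  have "x i * x i \<le> inner_on V x x"
    unfolding inner_on_def using assms by (intro member_le_sum) auto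
  then show ?thesis using assms by (simp add: abs_square_le_1[symmetric] power2_eq_square)
qed

text \<open>Rounding towards zero instead of to the nearest integer: a rounded vector is never
  longer, so it stays in the ball.\<close>

lemma trunc_int_exists:
  fixes r :: real
  shows "\<exists>z::int. \<bar>real_of_int z\<bar> \<le> \<bar>r\<bar> \<and> \<bar>r - z\<bar> \<le> 1"
proof (cases "r \<ge> 0")
  case True
  then have "0 \<le> \<lfloor>r\<rfloor>" by simp
  with True show ?thesis by (intro exI[of _ "\<lfloor>r\<rfloor>"] conjI) linarith+
next
  case False
  then have "\<lceil>r\<rceil> \<le> 0" by simp
  with False show ?thesis by (intro exI[of _ "\<lceil>r\<rceil>"] conjI) linarith+
qed

lemma lattice_net_step:
  assumes V: "finite V" "card V = n" "0 < n" and sym: "symmetric_on V X"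
    and lattice: "\<And>z::nat \<Rightarrow> int. (\<Sum>i\<in>V. (z i)\<^sup>2) \<le> 16 * int n \<Longrightarrow>
      \<bar>inner_on V z (mat_vec_on V X z)\<bar> \<le> 32 * real n * sqrt (real n)"
    and m: "0 \<le> m" "\<And>x. \<bar>inner_on V x (mat_vec_on V X x)\<bar> \<le> m * inner_on V x x"
    and x: "inner_on V x x \<le> 1"
  shows "\<bar>inner_on V x (mat_vec_on V X x)\<bar> \<le> 2 * sqrt n + m / 2"
proof -
  \<comment> \<open>After rescaling, each coordinate errs by at most \<open>1 / r\<close>, hence the
    vector by at most 1/4; and \<open>r^2 = 16 * n\<close> is the squared radius in the hypothesis
    on lattice points, whose bound becomes \<open>2 * sqrt n\<close> after division by
    \<open>r^2\<close>.\<close>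
  define r where "r = 4 * sqrt n"
  have r: "r > 0" "r\<^sup>2 = 16 * real n" using V by (auto simp: r_def power_mult_distrib)
  have "\<forall>i. \<exists>z::int. \<bar>real_of_int z\<bar> \<le> \<bar>r * x i\<bar> \<and> \<bar>r * x i - z\<bar> \<le> 1"
    by (intro allI trunc_int_exists)
  then obtain z :: "nat \<Rightarrow> int" where
    "\<forall>i. \<bar>real_of_int (z i)\<bar> \<le> \<bar>r * x i\<bar> \<and> \<bar>r * x i - z i\<bar> \<le> 1"
    by (rule choice[THEN exE])
  then have z: "\<And>i. \<bar>real_of_int (z i)\<bar> \<le> \<bar>r * x i\<bar>" "\<And>i. \<bar>r * x i - z i\<bar> \<le> 1"
    by blast+
  define y where "y = (\<lambda>i. 1 / r * real_of_int (z i))"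
  have zz: "real_of_int ((z i)\<^sup>2) \<le> r\<^sup>2 * (x i * x i)" for i
  proof -
    have "(real_of_int (z i))\<^sup>2 \<le> (r * x i)\<^sup>2" using z(1) by (simp add: abs_le_square_iff[symmetric])
    then show ?thesis by (simp add: power_mult_distrib power2_eq_square mult_ac)
  qed
  have "real_of_int (\<Sum>i\<in>V. (z i)\<^sup>2) \<le> (\<Sum>i\<in>V. r\<^sup>2 * (x i * x i))"
    unfolding of_int_sum by (intro sum_mono zz)
  also have "\<dots> = r\<^sup>2 * inner_on V x x" by (simp add: inner_on_def sum_distrib_left)
  also have "\<dots> \<le> r\<^sup>2 * 1" using x by (intro mult_left_mono) auto
  finally have zn: "(\<Sum>i\<in>V. (z i)\<^sup>2) \<le> 16 * int n" using r by linarith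
  have yQ: "\<bar>inner_on V y (mat_vec_on V X y)\<bar> \<le> 2 * sqrt n"
  proof -
    have "\<bar>inner_on V y (mat_vec_on V X y)\<bar> = \<bar>inner_on V z (mat_vec_on V X z)\<bar> / r\<^sup>2"
      unfolding y_def mat_vec_on_scale inner_on_scale_left inner_on_scale_right
      using r(1) by (simp add: abs_mult power2_eq_square)
    also have "\<dots> \<le> 32 * real n * sqrt (real n) / r\<^sup>2" by (intro divide_right_mono lattice zn) auto
    finally show ?thesis using r V by simp
  qed
  have ny: "L2_set y V \<le> 1"
  proof -
    have "y i * y i \<le> x i * x i" for i
      using zz[of i] r(1) by (simp add: y_def power2_eq_square field_simps)
    then have "inner_on V y y \<le> inner_on V x x" unfolding inner_on_def by (intro sum_mono)
    then show ?thesis using x by (simp add: L2_set_eq_sqrt)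
  qed
  have nx: "L2_set x V \<le> 1" using x by (simp add: L2_set_eq_sqrt)
  have nd: "L2_set (\<lambda>i. x i - y i) V \<le> 1 / 4"
  proof (rule power2_le_imp_le)
    have "(x i - y i) * (x i - y i) \<le> 1 / r\<^sup>2" for i
    proof -
      have "r * (x i - y i) = r * x i - z i" using r(1) by (simp add: y_def algebra_simps)
      then have "(r * (x i - y i))\<^sup>2 \<le> 1" using z(2)[of i] by (simp add: abs_square_le_1)
      then show ?thesis using r(1) by (simp add: field_simps power2_eq_square)
    qed
    then have "inner_on V (\<lambda>i. x i - y i) (\<lambda>i. x i - y i) \<le> (\<Sum>i\<in>V. 1 / r\<^sup>2)"
      unfolding inner_on_def by (intro sum_mono)
    also have "\<dots> = (1 / 4)\<^sup>2" using r V by (simp add: power2_eq_square)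
    finally show "(L2_set (\<lambda>i. x i - y i) V)\<^sup>2 \<le> (1 / 4)\<^sup>2" by (simp only: L2_set_power2)
  qed simp
  \<comment> \<open>Difference of two squares, valid by symmetry; the factors have norms at most 1/4
    and 2, which gives \<open>m / 2\<close>.\<close>
  have "inner_on V x (mat_vec_on V X x) - inner_on V y (mat_vec_on V X y)
      = inner_on V (\<lambda>i. x i - y i) (mat_vec_on V X (\<lambda>i. x i + y i))"
    using inner_on_mat_vec_symmetric[OF sym, of x y] inner_on_commute[of V "mat_vec_on V X x" y]
    by (simp add: mat_vec_on_add inner_on_diff_left inner_on_add_right)
  moreover have "\<bar>inner_on V (\<lambda>i. x i - y i) (mat_vec_on V X (\<lambda>i. x i + y i))\<bar>
      \<le> m * L2_set (\<lambda>i. x i - y i) V * L2_set (\<lambda>i. x i + y i) V"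
    by (rule symmetric_form_bound_polarization[OF V(1) sym m])
  moreover have "m * L2_set (\<lambda>i. x i - y i) V * L2_set (\<lambda>i. x i + y i) V \<le> m * (1 / 4) * 2"
  proof (intro mult_mono)
    show "L2_set (\<lambda>i. x i + y i) V \<le> 2"
      using L2_set_triangle_ineq[of x y V] nx ny by linarith
  qed (use m nd in auto)
  ultimately show ?thesis using yQ by linarith
qed

text \<open>
  A unit vector is within distance 1/4 of a point of the lattice of mesh $1/(4 \sqrt n)$ in the unit
  ball, so the quadratic form changes by at most half of its supremum.
\<close>

lemma form_bound_from_lattice:
  assumes V: "finite V" "card V = n" "0 < n" and sym: "symmetric_on V X"
    and lattice: "\<And>z::nat \<Rightarrow> int. (\<Sum>i\<in>V. (z i)\<^sup>2) \<le> 16 * int n \<Longrightarrow>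
      \<bar>inner_on V z (mat_vec_on V X z)\<bar> \<le> 32 * real n * sqrt (real n)"
  shows "\<bar>inner_on V x (mat_vec_on V X y)\<bar> \<le> 4 * sqrt n * L2_set x V * L2_set y V"
proof -
  define Q where "Q = (\<lambda>x. \<bar>inner_on V x (mat_vec_on V X x)\<bar>)"
  define U where "U = {x. inner_on V x x \<le> 1}"
  define m where "m = (SUP x\<in>U. Q x)"
  have zero: "(\<lambda>_. 0) \<in> U" by (simp add: U_def inner_on_def)
  \<comment> \<open>A crude bound is enough: it makes \<open>m\<close> a genuine supremum, so that
    \<open>m / 2\<close> can be absorbed below.\<close>
  have bdd: "bdd_above (Q ` U)"
  proof (rule bdd_aboveI2)
    fix x assume "x \<in> U"
    then have x: "\<And>i. i \<in> V \<Longrightarrow> \<bar>x i\<bar> \<le> 1" using abs_le_1_if_inner_le_1[OF V(1)] by (simp add: U_def)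
    have "Q x \<le> (\<Sum>i\<in>V. \<bar>\<Sum>j\<in>V. x i * x j * X i j\<bar>)"
      unfolding Q_def inner_on_mat_vec by (rule sum_abs)
    also have "\<dots> \<le> (\<Sum>i\<in>V. \<Sum>j\<in>V. \<bar>x i * x j * X i j\<bar>)"
      by (intro sum_mono sum_abs)
    also have "\<dots> \<le> (\<Sum>i\<in>V. \<Sum>j\<in>V. \<bar>X i j\<bar>)"
    proof (intro sum_mono)
      fix i j assume "i \<in> V" "j \<in> V"
      then have "\<bar>x i\<bar> * \<bar>x j\<bar> \<le> 1 * 1" using x by (intro mult_mono) auto
      then have "\<bar>x i\<bar> * \<bar>x j\<bar> * \<bar>X i j\<bar> \<le> 1 * \<bar>X i j\<bar>" by (intro mult_right_mono) auto
      then show "\<bar>x i * x j * X i j\<bar> \<le> \<bar>X i j\<bar>" by (simp add: abs_mult)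
    qed
    finally show "Q x \<le> (\<Sum>i\<in>V. \<Sum>j\<in>V. \<bar>X i j\<bar>)" .
  qed
  have m_upper: "Q x \<le> m" if "x \<in> U" for x
    unfolding m_def using bdd that by (rule cSUP_upper2[OF _ _ order_refl])
  have m0: "0 \<le> m" using m_upper[OF zero] by (simp add: Q_def)
  have quad: "\<bar>inner_on V x (mat_vec_on V X x)\<bar> \<le> m * inner_on V x x" for x
  proof (cases "inner_on V x x = 0")
    case True
    then have "\<forall>i\<in>V. x i = 0" using inner_on_eq_0[OF V(1)] by blast
    then show ?thesis by (simp add: inner_on_def)
  next
    case False
    define N where "N = inner_on V x x"
    have N: "N > 0" using False inner_on_ge_0[of V x] by (simp add: N_def)
    have "inner_on V (\<lambda>i. 1 / sqrt N * x i) (\<lambda>i. 1 / sqrt N * x i) = 1"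
      unfolding inner_on_scale_left inner_on_scale_right N_def[symmetric] using N by simp
    then have "Q (\<lambda>i. 1 / sqrt N * x i) \<le> m" by (intro m_upper) (simp add: U_def)
    moreover have "Q (\<lambda>i. 1 / sqrt N * x i) = Q x / N"
      unfolding Q_def mat_vec_on_scale inner_on_scale_left inner_on_scale_right
      using N by (simp add: abs_mult)
    ultimately show ?thesis using N by (simp add: Q_def N_def pos_divide_le_eq)
  qed
  have "m \<le> 2 * sqrt n + m / 2"
    unfolding m_def
  proof (rule cSUP_least)
    show "U \<noteq> {}" using zero by blast
    fix x assume "x \<in> U"
    then show "Q x \<le> 2 * sqrt n + (SUP x\<in>U. Q x) / 2"
      unfolding Q_def[symmetric] m_def[symmetric] using lattice_net_step[OF V sym lattice m0 quad, of x]
      by (simp add: Q_def U_def)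
  qed
  then have m4: "m \<le> 4 * sqrt n" by simp
  have "\<bar>inner_on V x (mat_vec_on V X y)\<bar> \<le> m * L2_set x V * L2_set y V"
    by (rule symmetric_form_bound_polarization[OF V(1) sym m0 quad])
  also have "\<dots> \<le> 4 * sqrt n * L2_set x V * L2_set y V"
    using m4 by (intro mult_right_mono) auto
  finally show ?thesis .
qed

section \<open>Counting lattice points in the ball\<close>

lemma sum_power_abs_int:
  "(\<Sum>a\<in>{- int m..int m}. (4/5 :: real) ^ nat \<bar>a\<bar>) = 9 - 8 * (4/5) ^ m"
proof (induction m)
  case (Suc m)
  have "{- int (Suc m)..int (Suc m)} = insert (- int (Suc m)) (insert (int (Suc m)) {- int m..int m})"
    by auto
  then show ?case using Suc by (simp add: nat_add_distrib)
qed simp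

lemma sum_abs_le_if_sum_squares_le:
  fixes z :: "nat \<Rightarrow> int"
  assumes "card V = n" "(\<Sum>i\<in>V. (z i)\<^sup>2) \<le> 16 * int n"
  shows "(\<Sum>i\<in>V. \<bar>z i\<bar>) \<le> 4 * int n"
proof -
  have "(\<Sum>i\<in>V. \<bar>z i\<bar>)\<^sup>2 \<le> int n * (\<Sum>i\<in>V. (z i)\<^sup>2)"
  proof -
    have "(\<Sum>i\<in>V. \<bar>real_of_int (z i)\<bar>)\<^sup>2 \<le> (\<Sum>i\<in>V. \<bar>real_of_int (z i)\<bar>\<^sup>2) * card V"
      by (rule sum_squared_le_sum_of_squares)
    then have "real_of_int ((\<Sum>i\<in>V. \<bar>z i\<bar>)\<^sup>2) \<le> real_of_int (int n * (\<Sum>i\<in>V. (z i)\<^sup>2))"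
      using assms(1) by (simp add: mult.commute)
    then show ?thesis by (simp only: of_int_le_iff)
  qed
  also have "\<dots> \<le> int n * (16 * int n)" using assms by (intro mult_left_mono) auto
  also have "\<dots> = (4 * int n)\<^sup>2" by (simp add: power2_eq_square)
  finally show ?thesis by (rule power2_le_imp_le) simp
qed

text \<open>The box provides a finite set of extensional functions over which a product expands. It
  cuts off nothing, as the squared-norm condition already gives coordinates of size at most
  \<open>4 * n\<close>.\<close>

definition lattice_points :: "nat set \<Rightarrow> nat \<Rightarrow> (nat \<Rightarrow> int) set" where
  "lattice_points V n =
     {z \<in> PiE V (\<lambda>_. {- int (4 * n)..int (4 * n)}). (\<Sum>i\<in>V. (z i)\<^sup>2) \<le> 16 * int n}"

lemma finite_lattice_points: "finite V \<Longrightarrow> finite (lattice_points V n)"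
  by (rule finite_subset[of _ "PiE V (\<lambda>_. {- int (4 * n)..int (4 * n)})"])
    (auto simp: lattice_points_def intro: finite_PiE)

text \<open>Giving \<open>z\<close> the weight $(4/5)^{\sum |z_i|}$ bounds the total weight by $9^n$.\<close>

lemma card_lattice_points:
  assumes "finite V" "card V = n"
  shows "real (card (lattice_points V n)) \<le> 22 ^ n"
proof -
  define B where "B = {- int (4 * n)..int (4 * n)}"
  have "real (card (lattice_points V n)) * (4/5) ^ (4 * n) = (\<Sum>z\<in>lattice_points V n. (4/5) ^ (4 * n))"
    by simp
  also have "\<dots> \<le> (\<Sum>z\<in>lattice_points V n. \<Prod>i\<in>V. (4/5) ^ nat \<bar>z i\<bar>)"
  proof (rule sum_mono)
    fix z assume "z \<in> lattice_points V n"
    then have "(\<Sum>i\<in>V. \<bar>z i\<bar>) \<le> 4 * int n"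
      using assms by (intro sum_abs_le_if_sum_squares_le) (auto simp: lattice_points_def)
    moreover have "int (\<Sum>i\<in>V. nat \<bar>z i\<bar>) = (\<Sum>i\<in>V. \<bar>z i\<bar>)" by simp
    \<comment> \<open>Hence every point of the ball carries weight at least
      \<open>(4/5) ^ (4 * n)\<close>.\<close>
    ultimately have "(\<Sum>i\<in>V. nat \<bar>z i\<bar>) \<le> 4 * n" by linarith
    then show "(4/5 :: real) ^ (4 * n) \<le> (\<Prod>i\<in>V. (4/5) ^ nat \<bar>z i\<bar>)"
      unfolding power_sum[symmetric] by (intro power_decreasing) auto
  qed
  also have "\<dots> \<le> (\<Sum>z\<in>PiE V (\<lambda>_. B). \<Prod>i\<in>V. (4/5) ^ nat \<bar>z i\<bar>)"
    using assms by (intro sum_mono2 finite_PiE prod_nonneg) (auto simp: lattice_points_def B_def)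
  also have "\<dots> = (\<Prod>i\<in>V. \<Sum>a\<in>B. (4/5) ^ nat \<bar>a\<bar>)"
    by (rule prod_sum_PiE[symmetric]) (use assms in \<open>auto simp: B_def\<close>)
  \<comment> \<open>9 is the two-sided geometric series \<open>(1 + x) / (1 - x)\<close> at
    \<open>x = 4/5\<close>.\<close>
  also have "\<dots> \<le> (\<Prod>i\<in>V. 9)"
  proof (intro prod_mono conjI)
    show "(\<Sum>a\<in>B. (4/5 :: real) ^ nat \<bar>a\<bar>) \<le> 9" unfolding B_def sum_power_abs_int by simp
  qed (simp add: sum_nonneg)
  also have "\<dots> = 9 ^ n" using assms by simp
  finally have "real (card (lattice_points V n)) \<le> 9 ^ n / (4/5) ^ (4 * n)"
    by (simp add: pos_le_divide_eq)
  also have "\<dots> = (9 / (4/5) ^ 4) ^ n" by (simp only: power_mult power_divide)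
  \<comment> \<open>\<open>9 * (5/4)^4\<close> is about 21.97.\<close>
  also have "\<dots> \<le> 22 ^ n" by (intro power_mono) (auto simp: power_divide)
  finally show ?thesis .
qed

lemma restrict_lattice_points:
  fixes z :: "nat \<Rightarrow> int"
  assumes "finite V" "card V = n" "(\<Sum>i\<in>V. (z i)\<^sup>2) \<le> 16 * int n"
  shows "restrict z V \<in> lattice_points V n"
proof -
  have "\<bar>z i\<bar> \<le> 4 * int n" if "i \<in> V" for i
    using member_le_sum[of i V "\<lambda>i. \<bar>z i\<bar>"] that assms sum_abs_le_if_sum_squares_le[of V n z] by auto
  then show ?thesis using assms(3) by (auto simp: lattice_points_def abs_le_iff minus_le_iff)
qed

section \<open>Concentration of the random graph\<close>

lemma finite_all_edges: "finite V \<Longrightarrow> finite (all_edges V)"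
  by (rule finite_subset[of _ "Pow V"]) (auto simp: all_edges_def)

lemma sum_pairs_eq_sum_edges:
  fixes f :: "nat set \<Rightarrow> real"
  assumes "finite V"
  shows "(\<Sum>i\<in>V. \<Sum>j\<in>V. if i = j then 0 else f {i, j}) = 2 * (\<Sum>e\<in>all_edges V. f e)"
  using assms
proof (induction V rule: finite_induct)
  case empty
  have "all_edges {} = {}" by (auto simp: all_edges_def)
  then show ?case by simp
next
  case (insert v V)
  have edges: "all_edges (insert v V) = all_edges V \<union> (\<lambda>j. {v, j}) ` V" (is "?L = ?R")
  proof
    show "?R \<subseteq> ?L" using insert.hyps by (auto simp: all_edges_def card_insert_if)
    show "?L \<subseteq> ?R"
    proof
      fix e assume "e \<in> ?L"
      then have e: "e \<subseteq> insert v V" "card e = 2" by (auto simp: all_edges_def)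
      show "e \<in> ?R"
      proof (cases "v \<in> e")
        case False
        then show ?thesis using e by (auto simp: all_edges_def)
      next
        case True
        obtain a b where ab: "e = {a, b}" "a \<noteq> b" using e by (auto simp: card_2_iff)
        then have "e = {v, if v = a then b else a}" "(if v = a then b else a) \<in> V"
          using True e by auto
        then show ?thesis by blast
      qed
    qed
  qed
  have disj: "all_edges V \<inter> (\<lambda>j. {v, j}) ` V = {}" using insert.hyps by (auto simp: all_edges_def)
  have inj: "inj_on (\<lambda>j. {v, j}) V" by (auto simp: inj_on_def doubleton_eq_iff)
  have R: "(\<Sum>e\<in>all_edges (insert v V). f e) = (\<Sum>e\<in>all_edges V. f e) + (\<Sum>j\<in>V. f {v, j})"
    unfolding edges using insert.hyps disj inj
    by (subst sum.union_disjoint) (auto simp: finite_all_edges sum.reindex)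
  have "(\<Sum>j\<in>V. if v = j then 0 else f {v, j}) = (\<Sum>j\<in>V. f {v, j})"
    using insert.hyps by (intro sum.cong) auto
  moreover have "(\<Sum>i\<in>V. if i = v then 0 else f {i, v}) = (\<Sum>j\<in>V. f {v, j})"
    using insert.hyps by (intro sum.cong) (auto simp: insert_commute)
  ultimately have "(\<Sum>i\<in>insert v V. \<Sum>j\<in>insert v V. if i = j then 0 else f {i, j})
      = 2 * (\<Sum>j\<in>V. f {v, j}) + (\<Sum>i\<in>V. \<Sum>j\<in>V. if i = j then 0 else f {i, j})"
    using insert.hyps by (simp add: sum.distrib)
  then show ?case using R insert.IH by simp
qed

definition edge_prob :: "nat set set \<Rightarrow> real \<Rightarrow> real \<Rightarrow> nat set \<Rightarrow> real" where
  "edge_prob \<C> p q e = (if \<exists>C\<in>\<C>. e \<subseteq> C then p else q)"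

text \<open>A centred linear form in independent edge indicators. The noise form and the degree
  deviations are both of this kind, so one Hoeffding bound covers them.\<close>

definition edge_form :: "nat set \<Rightarrow> nat set set \<Rightarrow> real \<Rightarrow> real \<Rightarrow> (nat set \<Rightarrow> real) \<Rightarrow> nat set set \<Rightarrow> real" where
  "edge_form V \<C> p q b E = (\<Sum>e\<in>all_edges V. b e * (of_bool (e \<in> E) - edge_prob \<C> p q e))"

lemma planted_partition_hoeffding:
  assumes pq: "0 \<le> q" "q \<le> 1" "0 \<le> p" "p \<le> 1" and t: "0 \<le> t"
    and K: "0 < K" "(\<Sum>e\<in>all_edges {1..n}. (b e)\<^sup>2) \<le> K"
  shows "measure_pmf.prob (planted_partition n \<C> p q) {E. t \<le> \<bar>edge_form {1..n} \<C> p q b E\<bar>}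
      \<le> 2 * exp (- 2 * t\<^sup>2 / K)"
proof -
  define I where "I = all_edges {1..n}"
  define D where "D = Pi_pmf I False (\<lambda>e. bernoulli_pmf (edge_prob \<C> p q e))"
  define Y where "Y = (\<lambda>e f. b e * of_bool (f e) :: real)"
  have fin: "finite I" by (simp add: I_def finite_all_edges)
  have ep: "0 \<le> edge_prob \<C> p q e" "edge_prob \<C> p q e \<le> 1" for e
    using pq by (auto simp: edge_prob_def)
  have "measure_pmf.prob (planted_partition n \<C> p q) {E. t \<le> \<bar>edge_form {1..n} \<C> p q b E\<bar>}
      = measure_pmf.prob D {f. t \<le> \<bar>edge_form {1..n} \<C> p q b {e \<in> I. f e}\<bar>}"
    unfolding planted_partition_def D_def I_def edge_prob_def by (simp add: vimage_def)
  also have "(\<lambda>f. edge_form {1..n} \<C> p q b {e \<in> I. f e})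
      = (\<lambda>f. (\<Sum>e\<in>I. Y e f) - (\<Sum>e\<in>I. b e * edge_prob \<C> p q e))"
    by (simp add: edge_form_def I_def Y_def sum_subtractf[symmetric] algebra_simps)
  then have "{f. t \<le> \<bar>edge_form {1..n} \<C> p q b {e \<in> I. f e}\<bar>}
      = {f. t \<le> \<bar>(\<Sum>e\<in>I. Y e f) - (\<Sum>e\<in>I. b e * edge_prob \<C> p q e)\<bar>}"
    by (simp add: fun_eq_iff)
  also have "measure_pmf.prob D \<dots> \<le> 2 * exp (- 2 * t\<^sup>2 / K)"
  \<comment> \<open>Hoeffding's bound divides by this sum. If it is 0, the form vanishes
    identically, and for \<open>t = 0\<close> the claimed bound is 2.\<close>
  proof (cases "(\<Sum>e\<in>I. (b e)\<^sup>2) = 0")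
    case True
    then have b0: "\<forall>e\<in>I. b e = 0" using fin by (simp add: sum_nonneg_eq_0_iff)
    show ?thesis
    proof (cases "t = 0")
      case True
      have "measure_pmf.prob D {f. t \<le> \<bar>(\<Sum>e\<in>I. Y e f) - (\<Sum>e\<in>I. b e * edge_prob \<C> p q e)\<bar>} \<le> 1"
        by (rule measure_pmf.prob_le_1)
      then show ?thesis using True by simp
    next
      case False
      then have "{f. t \<le> \<bar>(\<Sum>e\<in>I. Y e f) - (\<Sum>e\<in>I. b e * edge_prob \<C> p q e)\<bar>} = {}"
        using b0 t by (auto simp: Y_def)
      then show ?thesis by simp
    qed
  next
    case False
    then have pos: "(\<Sum>e\<in>I. (b e)\<^sup>2) > 0" by (simp add: order_less_le sum_nonneg)
    \<comment> \<open>\<open>b e\<close> may have either sign, so \<open>Y e\<close> ranges between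
      0 and \<open>b e\<close> in either order; the length of the range is the absolute value of
      \<open>b e\<close>.\<close>
    interpret Hoeffding_ineq "measure_pmf D" I Y "\<lambda>e. min 0 (b e)" "\<lambda>e. max 0 (b e)"
      "\<Sum>e\<in>I. measure_pmf.expectation D (Y e)"
    proof unfold_locales
      show "finite I" by (rule fin)
      show "prob_space.indep_vars (measure_pmf D) (\<lambda>_. borel) Y I"
        unfolding D_def Y_def
        by (intro prob_space.indep_vars_compose2[OF _ indep_vars_Pi_pmf[OF fin]])
          (auto simp: measure_pmf.prob_space_axioms)
    qed (auto simp: Y_def)
    have exp: "measure_pmf.expectation D (Y e) = b e * edge_prob \<C> p q e" if "e \<in> I" for e
    proof -
      have "measure_pmf.expectation D (Y e)
          = measure_pmf.expectation (map_pmf (\<lambda>f. f e) D) (\<lambda>x. b e * of_bool x)"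
        by (simp add: Y_def)
      also have "map_pmf (\<lambda>f. f e) D = bernoulli_pmf (edge_prob \<C> p q e)"
        unfolding D_def using that fin by (simp add: Pi_pmf_component)
      finally show ?thesis using ep[of e] by simp
    qed
    have sq: "(max 0 (b e) - min 0 (b e))\<^sup>2 = (b e)\<^sup>2" for e
      by (auto simp: max_def min_def)
    have "measure_pmf.prob D {f. t \<le> \<bar>(\<Sum>e\<in>I. Y e f) - (\<Sum>e\<in>I. b e * edge_prob \<C> p q e)\<bar>}
        \<le> 2 * exp (- 2 * t\<^sup>2 / (\<Sum>e\<in>I. (b e)\<^sup>2))"
      using Hoeffding_ineq_abs_ge[OF t] pos by (simp add: sq exp)
    also have "\<dots> \<le> 2 * exp (- 2 * t\<^sup>2 / K)"
    proof -
      have "t\<^sup>2 / K \<le> t\<^sup>2 / (\<Sum>e\<in>I. (b e)\<^sup>2)"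
        using pos K by (intro divide_left_mono) (auto simp: I_def)
      then show ?thesis by simp
    qed
    finally show ?thesis .
  qed
  finally show ?thesis .
qed

lemma noise_matrix_edge:
  assumes "i \<noteq> j"
  shows "noise_matrix E \<C> p q i j = of_bool ({i, j} \<in> E) - edge_prob \<C> p q {i, j}"
  using assms by (simp add: noise_matrix_def adjacency_def mean_adjacency_def edge_prob_def)

lemma noise_matrix_diag: "E \<subseteq> all_edges V \<Longrightarrow> noise_matrix E \<C> p q i i = 0"
  by (auto simp: noise_matrix_def adjacency_def mean_adjacency_def all_edges_def)

lemma symmetric_noise_matrix: "symmetric_on V (noise_matrix E \<C> p q)"
  by (auto simp: symmetric_on_def noise_matrix_def adjacency_def mean_adjacency_def insert_commute conj_commute)

text \<open>The diagonal is zero and each edge occurs in both orders, hence the factor 2.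
  \<open>prod z e\<close> is the product over both endpoints, with no need to order them.\<close>

lemma noise_form_eq_edge_form:
  assumes "finite V" "E \<subseteq> all_edges V"
  shows "inner_on V z (mat_vec_on V (noise_matrix E \<C> p q) z) = edge_form V \<C> p q (\<lambda>e. 2 * prod z e) E"
proof -
  have "inner_on V z (mat_vec_on V (noise_matrix E \<C> p q) z) = (\<Sum>i\<in>V. \<Sum>j\<in>V.
      if i = j then 0 else prod z {i, j} * (of_bool ({i, j} \<in> E) - edge_prob \<C> p q {i, j}))"
    unfolding inner_on_mat_vec
    by (intro sum.cong refl) (auto simp: noise_matrix_diag[OF assms(2)] noise_matrix_edge)
  also have "\<dots> = 2 * (\<Sum>e\<in>all_edges V. prod z e * (of_bool (e \<in> E) - edge_prob \<C> p q e))"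
    by (rule sum_pairs_eq_sum_edges[OF assms(1)])
  finally show ?thesis by (simp add: edge_form_def sum_distrib_left mult.assoc)
qed

lemma edge_coefficients_square_sum:
  fixes z :: "nat \<Rightarrow> real"
  assumes "finite V"
  shows "(\<Sum>e\<in>all_edges V. (2 * prod z e)\<^sup>2) \<le> 2 * (\<Sum>i\<in>V. (z i)\<^sup>2)\<^sup>2"
proof -
  have "(\<Sum>e\<in>all_edges V. (2 * prod z e)\<^sup>2) = 2 * (2 * (\<Sum>e\<in>all_edges V. (prod z e)\<^sup>2))"
    by (simp add: power_mult_distrib sum_distrib_left)
  also have "2 * (\<Sum>e\<in>all_edges V. (prod z e)\<^sup>2)
      = (\<Sum>i\<in>V. \<Sum>j\<in>V. if i = j then 0 else (prod z {i, j})\<^sup>2)"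
    by (rule sum_pairs_eq_sum_edges[OF assms, symmetric])
  also have "\<dots> \<le> (\<Sum>i\<in>V. \<Sum>j\<in>V. (z i)\<^sup>2 * (z j)\<^sup>2)"
    by (intro sum_mono) (auto simp: power_mult_distrib)
  also have "\<dots> = (\<Sum>i\<in>V. (z i)\<^sup>2)\<^sup>2"
    by (simp add: power2_eq_square[of "sum _ _"] sum_product)
  finally show ?thesis by simp
qed

text \<open>Turns the degree of \<open>v\<close> into \<open>C\<close> into an edge form;
  \<open>v\<close> is removed because \<open>{v, v}\<close> is not an edge.\<close>

definition star_coefficients :: "nat \<Rightarrow> nat set \<Rightarrow> nat set \<Rightarrow> real" where
  "star_coefficients v C e = of_bool (e \<in> (\<lambda>j. {v, j}) ` (C - {v}))"

lemma sum_star: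
  fixes f :: "nat set \<Rightarrow> real"
  assumes "finite V" "C \<subseteq> V" "v \<in> V"
  shows "(\<Sum>e\<in>all_edges V. star_coefficients v C e * f e) = (\<Sum>j\<in>C - {v}. f {v, j})"
proof -
  have sub: "(\<lambda>j. {v, j}) ` (C - {v}) \<subseteq> all_edges V"
    using assms by (auto simp: all_edges_def card_insert_if)
  have "(\<Sum>e\<in>all_edges V. star_coefficients v C e * f e) = (\<Sum>e\<in>(\<lambda>j. {v, j}) ` (C - {v}). f e)"
    using sub by (intro sum.mono_neutral_cong_right)
      (auto simp: finite_all_edges assms star_coefficients_def)
  also have "\<dots> = (\<Sum>j\<in>C - {v}. f {v, j})"
    by (subst sum.reindex) (auto simp: inj_on_def doubleton_eq_iff)
  finally show ?thesis .
qed

lemma degree_eq_edge_form: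
  assumes "finite V" "C \<subseteq> V" "v \<in> V" "E \<subseteq> all_edges V"
  shows "real (num_neighbors_in E C v) - (\<Sum>j\<in>C. mean_adjacency \<C> p q v j)
    = edge_form V \<C> p q (star_coefficients v C) E"
proof -
  have finC: "finite C" using assms finite_subset by blast
  have "real (num_neighbors_in E C v) = (\<Sum>j\<in>C. adjacency E v j)"
    using finC by (simp add: num_neighbors_in_def adjacency_def sum.If_cases Int_def)
  then have "real (num_neighbors_in E C v) - (\<Sum>j\<in>C. mean_adjacency \<C> p q v j)
      = (\<Sum>j\<in>C. noise_matrix E \<C> p q v j)"
    by (simp add: noise_matrix_def sum_subtractf)
  also have "\<dots> = (\<Sum>j\<in>C - {v}. of_bool ({v, j} \<in> E) - edge_prob \<C> p q {v, j})"
    using finC by (intro sum.mono_neutral_cong_right)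
      (auto simp: noise_matrix_diag[OF assms(4)] noise_matrix_edge)
  also have "\<dots> = edge_form V \<C> p q (star_coefficients v C) E"
    unfolding edge_form_def by (rule sum_star[OF assms(1-3), symmetric])
  finally show ?thesis .
qed

lemma star_coefficients_square_sum:
  assumes "finite V" "C \<subseteq> V" "v \<in> V"
  shows "(\<Sum>e\<in>all_edges V. (star_coefficients v C e)\<^sup>2) \<le> card C"
proof -
  have "(\<Sum>e\<in>all_edges V. (star_coefficients v C e)\<^sup>2) = (\<Sum>e\<in>all_edges V. star_coefficients v C e * 1)"
    by (intro sum.cong) (auto simp: star_coefficients_def)
  also have "\<dots> = card (C - {v})" unfolding sum_star[OF assms] by simp
  also have "\<dots> \<le> card C"
    using assms finite_subset[of C V] by (simp add: card_mono)
  finally show ?thesis .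
qed

text \<open>At \<open>K = 2 * (16 * n)^2\<close> the Hoeffding exponent is \<open>4 * n\<close>,
  enough to beat the \<open>22 ^ n\<close> lattice points because \<open>22 < exp 4\<close>.\<close>

lemma noise_event_prob:
  assumes pq: "0 \<le> q" "q \<le> 1" "0 \<le> p" "p \<le> 1" and n: "0 < n"
  shows "measure_pmf.prob (planted_partition n \<C> p q)
    (\<Union>z\<in>lattice_points {1..n} n.
       {E. 32 * real n * sqrt (real n) \<le> \<bar>edge_form {1..n} \<C> p q (\<lambda>e. 2 * (\<Prod>i\<in>e. real_of_int (z i))) E\<bar>})
    \<le> 2 * (22 * exp (- 4)) ^ n" (is "measure_pmf.prob ?D (\<Union>z\<in>?Z. ?B z) \<le> _")
proof -
  have fin: "finite ?Z" by (simp add: finite_lattice_points)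
  have "measure_pmf.prob ?D (?B z) \<le> 2 * exp (- 4 * real n)" if "z \<in> ?Z" for z
  proof -
    have "real_of_int (\<Sum>i\<in>{1..n}. (z i)\<^sup>2) \<le> real_of_int (16 * int n)"
      using that by (simp only: of_int_le_iff) (simp add: lattice_points_def)
    then have "(\<Sum>i\<in>{1..n}. (real_of_int (z i))\<^sup>2)\<^sup>2 \<le> (16 * real n)\<^sup>2"
      by (intro power_mono) (auto simp: sum_nonneg)
    then have "(\<Sum>e\<in>all_edges {1..n}. (2 * (\<Prod>i\<in>e. real_of_int (z i)))\<^sup>2) \<le> 2 * (16 * real n)\<^sup>2"
      using edge_coefficients_square_sum[of "{1..n}" "\<lambda>i. real_of_int (z i)"] by simp
    then have "measure_pmf.prob ?D (?B z) \<le> 2 * exp (- 2 * (32 * real n * sqrt (real n))\<^sup>2 / (2 * (16 * real n)\<^sup>2))"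
      using n by (intro planted_partition_hoeffding pq) auto
    also have "- 2 * (32 * real n * sqrt (real n))\<^sup>2 / (2 * (16 * real n)\<^sup>2) = - 4 * real n"
      using n by (simp add: power_mult_distrib power2_eq_square)
    finally show ?thesis .
  qed
  then have "measure_pmf.prob ?D (\<Union>z\<in>?Z. ?B z) \<le> (\<Sum>z\<in>?Z. 2 * exp (- 4 * real n))"
    by (intro order_trans[OF measure_pmf.finite_measure_subadditive_finite[OF fin]] sum_mono) auto
  also have "\<dots> = card ?Z * (2 * exp (- 4 * real n))" by simp
  also have "\<dots> \<le> 22 ^ n * (2 * exp (- 4 * real n))"
    using card_lattice_points[of "{1..n}" n] by (intro mult_right_mono) auto
  also have "\<dots> = 2 * (22 * exp (- 4)) ^ n"
    by (simp add: power_mult_distrib exp_of_nat_mult[symmetric] mult.commute)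
  finally show ?thesis .
qed

lemma degree_event_prob:
  fixes p q :: real
  assumes pq: "0 \<le> q" "q \<le> p" "p \<le> 1" and s: "0 < s"
    and part: "partition_on {1..n} \<C>" and size: "\<forall>C\<in>\<C>. card C = s"
  shows "measure_pmf.prob (planted_partition n \<C> p q)
    (\<Union>x\<in>{1..n} \<times> \<C>.
       {E. (p - q) * s / 8 \<le> \<bar>edge_form {1..n} \<C> p q (star_coefficients (fst x) (snd x)) E\<bar>})
    \<le> n * card \<C> * (2 * exp (- ((p - q)\<^sup>2 * s / 32)))"
    (is "measure_pmf.prob ?D (\<Union>x\<in>?Z. ?B x) \<le> _")
proof -
  have fin: "finite ?Z" using finite_elements[OF _ part] by simp
  have "measure_pmf.prob ?D (?B x) \<le> 2 * exp (- ((p - q)\<^sup>2 * s / 32))" if "x \<in> ?Z" for x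
  proof -
    have x: "fst x \<in> {1..n}" "snd x \<in> \<C>" using that by auto
    have "snd x \<subseteq> {1..n}" using x(2) part by (auto simp: partition_on_def)
    then have "(\<Sum>e\<in>all_edges {1..n}. (star_coefficients (fst x) (snd x) e)\<^sup>2) \<le> real s"
      using star_coefficients_square_sum[of "{1..n}" "snd x" "fst x"] x size by simp
    then have "measure_pmf.prob ?D (?B x) \<le> 2 * exp (- 2 * ((p - q) * s / 8)\<^sup>2 / s)"
      using pq s by (intro planted_partition_hoeffding) auto
    also have "- 2 * ((p - q) * s / 8)\<^sup>2 / s = - ((p - q)\<^sup>2 * s / 32)"
      using s by (simp add: power2_eq_square)
    finally show ?thesis .
  qed
  then have "measure_pmf.prob ?D (\<Union>x\<in>?Z. ?B x) \<le> (\<Sum>x\<in>?Z. 2 * exp (- ((p - q)\<^sup>2 * s / 32)))"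
    by (intro order_trans[OF measure_pmf.finite_measure_subadditive_finite[OF fin]] sum_mono) auto
  then show ?thesis by (simp add: card_cartesian_product)
qed

section \<open>Typical graphs occur with high probability\<close>

lemma typical_graphI:
  fixes p q :: real
  assumes pq: "0 \<le> q" "q < p" "p \<le> 1" and n: "0 < n"
    and part: "partition_on {1..n} \<C>" and size: "\<forall>C\<in>\<C>. card C = s"
    and s: "72 * sqrt n \<le> (p - q)\<^sup>2 * s"
    and E: "E \<subseteq> all_edges {1..n}"
    and noise: "\<And>z. z \<in> lattice_points {1..n} n \<Longrightarrow>
      \<bar>edge_form {1..n} \<C> p q (\<lambda>e. 2 * (\<Prod>i\<in>e. real_of_int (z i))) E\<bar> \<le> 32 * real n * sqrt (real n)"
    and degree: "\<And>v C. v \<in> {1..n} \<Longrightarrow> C \<in> \<C> \<Longrightarrow>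
      \<bar>edge_form {1..n} \<C> p q (star_coefficients v C) E\<bar> \<le> (p - q) * s / 8"
  shows "typical_graph {1..n} \<C> s p q (4 * sqrt n) E"
proof
  define d where "d = p - q"
  define r where "r = sqrt n"
  have d: "0 < d" "d \<le> 1" and r: "1 \<le> r" using pq n by (auto simp: d_def r_def)
  have ds: "72 * r \<le> d\<^sup>2 * s" using s by (simp add: d_def r_def)
  have "d\<^sup>2 * s \<le> d * s"
    using d by (intro mult_right_mono) (auto simp: power2_eq_square mult_left_le)
  then have ds': "72 * r \<le> d * s" using ds by linarith
  show "finite {1..n}" by simp
  show "partition_on {1..n} \<C>" by fact
  show "card C = s" if "C \<in> \<C>" for C using size that by blast
  show "0 \<le> q" "p \<le> 1" by fact+
  show "E \<subseteq> all_edges {1..n}" by fact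
  show "0 \<le> 4 * sqrt n" by simp
  show "4 * sqrt n < (p - q) * s" using ds' r unfolding d_def r_def by linarith
  show "4 < (p - q) * s" using ds' r unfolding d_def by linarith
  \<comment> \<open>With \<open>d <= 1\<close>, \<open>d * (d * s - 4 * r)\<close> is at least
    \<open>72 * r - 4 * r\<close>, more than the required \<open>16 * 4 * r\<close>.\<close>
  show "4 * sqrt n / ((p - q) * s - 4 * sqrt n) \<le> (p - q) / 16"
  proof -
    have "d * r \<le> r" using d r by (simp add: mult_le_cancel_right1)
    moreover have "d * (d * s - 4 * r) = d\<^sup>2 * s - 4 * (d * r)"
      by (simp add: algebra_simps power2_eq_square)
    ultimately have "64 * r \<le> d * (d * s - 4 * r)" using ds r by linarith
    moreover have "0 < d * s - 4 * r" using ds' r by linarith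
    ultimately have "4 * r / (d * s - 4 * r) \<le> d / 16" by (simp add: field_simps)
    then show ?thesis by (simp add: d_def r_def)
  qed
  show "\<bar>real (num_neighbors_in E C v) - (\<Sum>j\<in>C. mean_adjacency \<C> p q v j)\<bar> \<le> (p - q) * s / 8"
    if "C \<in> \<C>" "v \<in> {1..n}" for C v
  proof -
    have "C \<subseteq> {1..n}" using that part by (auto simp: partition_on_def)
    then show ?thesis
      using degree_eq_edge_form[of "{1..n}" C v E \<C> p q] degree[of v C] that E by simp
  qed
  show "\<bar>inner_on {1..n} x (mat_vec_on {1..n} (noise_matrix E \<C> p q) y)\<bar>
      \<le> 4 * sqrt n * L2_set x {1..n} * L2_set y {1..n}" for x y
  proof (rule form_bound_from_lattice)
    show "symmetric_on {1..n} (noise_matrix E \<C> p q)" by (rule symmetric_noise_matrix)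
    fix z :: "nat \<Rightarrow> int"
    assume z: "(\<Sum>i\<in>{1..n}. (z i)\<^sup>2) \<le> 16 * int n"
    \<comment> \<open>Lattice points are extensional functions, and the form reads \<open>z\<close>
      only on the vertex set.\<close>
    define z' where "z' = restrict z {1..n}"
    have z': "z' \<in> lattice_points {1..n} n"
      unfolding z'_def by (rule restrict_lattice_points) (use z in auto)
    have "inner_on {1..n} z (mat_vec_on {1..n} (noise_matrix E \<C> p q) z)
        = inner_on {1..n} z' (mat_vec_on {1..n} (noise_matrix E \<C> p q) z')"
      unfolding inner_on_mat_vec by (intro sum.cong refl) (simp add: z'_def)
    also have "\<dots> = edge_form {1..n} \<C> p q (\<lambda>e. 2 * (\<Prod>i\<in>e. real_of_int (z' i))) E"
      by (rule noise_form_eq_edge_form[OF _ E]) simp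
    finally show "\<bar>inner_on {1..n} z (mat_vec_on {1..n} (noise_matrix E \<C> p q) z)\<bar> \<le> 32 * real n * sqrt (real n)"
      using noise[OF z'] by simp
  qed (use n in auto)
qed

lemma recovery_prob:
  fixes p q :: real
  assumes pq: "0 \<le> q" "q < p" "p \<le> 1" and n: "0 < n"
    and part: "partition_on {1..n} \<C>" and size: "\<forall>C\<in>\<C>. card C = s" and k: "card \<C> \<le> n"
    and s: "72 * sqrt n \<le> (p - q)\<^sup>2 * s"
  shows "measure_pmf.prob (planted_partition n \<C> p q) {E. {R. identify_clusters s {1..n} E R} = {\<C>}}
    \<ge> 1 - (2 * (22 * exp (- 4)) ^ n + 2 * (real n)\<^sup>2 * exp (- (9 / 4 * sqrt n)))"
proof -
  define D where "D = planted_partition n \<C> p q"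
  define G where "G = {E. {R. identify_clusters s {1..n} E R} = {\<C>}}"
  define B1 where "B1 = (\<Union>z\<in>lattice_points {1..n} n.
     {E. 32 * real n * sqrt (real n) \<le> \<bar>edge_form {1..n} \<C> p q (\<lambda>e. 2 * (\<Prod>i\<in>e. real_of_int (z i))) E\<bar>})"
  define B2 where "B2 = (\<Union>x\<in>{1..n} \<times> \<C>.
     {E. (p - q) * s / 8 \<le> \<bar>edge_form {1..n} \<C> p q (star_coefficients (fst x) (snd x)) E\<bar>})"
  \<comment> \<open>Membership in the support guarantees that \<open>E\<close> consists of edges on
    \<open>{1..n}\<close>.\<close>
  have "E \<in> G" if "E \<in> set_pmf D" "E \<notin> B1" "E \<notin> B2" for E
  proof -
    have "typical_graph {1..n} \<C> s p q (4 * sqrt n) E"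
    proof (rule typical_graphI[OF pq n part size s])
      show "E \<subseteq> all_edges {1..n}" using that(1) by (auto simp: D_def planted_partition_def)
      show "\<bar>edge_form {1..n} \<C> p q (\<lambda>e. 2 * (\<Prod>i\<in>e. real_of_int (z i))) E\<bar> \<le> 32 * real n * sqrt (real n)"
        if "z \<in> lattice_points {1..n} n" for z
        using \<open>E \<notin> B1\<close> that unfolding B1_def by (auto simp: not_le intro: less_imp_le)
      show "\<bar>edge_form {1..n} \<C> p q (star_coefficients v C) E\<bar> \<le> (p - q) * s / 8"
        if "v \<in> {1..n}" "C \<in> \<C>" for v C
        using \<open>E \<notin> B2\<close> that unfolding B2_def by (force simp: not_le intro: less_imp_le)
    qed
    then show ?thesis using typical_graph.identify_clusters_iff by (auto simp: G_def)
  qed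
  then have "measure_pmf.prob D (- G) \<le> measure_pmf.prob D (B1 \<union> B2)"
    by (intro measure_pmf.finite_measure_mono_AE) (auto simp: AE_measure_pmf_iff)
  also have "\<dots> \<le> measure_pmf.prob D B1 + measure_pmf.prob D B2"
    by (rule measure_Un_le) auto
  also have "measure_pmf.prob D B1 \<le> 2 * (22 * exp (- 4)) ^ n"
    unfolding D_def B1_def by (rule noise_event_prob) (use pq n in auto)
  also have "measure_pmf.prob D B2 \<le> 2 * (real n)\<^sup>2 * exp (- (9 / 4 * sqrt n))"
  proof -
    have "0 < s" using s n by (cases "s = 0") auto
    then have "measure_pmf.prob D B2 \<le> n * card \<C> * (2 * exp (- ((p - q)\<^sup>2 * s / 32)))"
      unfolding D_def B2_def using degree_event_prob[of q p s n \<C>] pq part size by simp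
    \<comment> \<open>The exponent is \<open>72 / 32 = 9 / 4\<close> times
      \<open>sqrt n\<close>.\<close>
    also have "\<dots> \<le> (real n * real n) * (2 * exp (- (9 / 4 * sqrt n)))"
      using k s by (intro mult_mono) (auto intro: mult_left_mono)
    finally show ?thesis by (simp add: power2_eq_square)
  qed
  finally have "measure_pmf.prob D (- G)
    \<le> 2 * (22 * exp (- 4)) ^ n + 2 * (real n)\<^sup>2 * exp (- (9 / 4 * sqrt n))" by simp
  moreover have "measure_pmf.prob D (- G) = 1 - measure_pmf.prob D G"
    using measure_pmf.prob_compl[of G D] by (simp add: Compl_eq_Diff_UNIV)
  ultimately show ?thesis unfolding D_def G_def by linarith
qed

lemma failure_tendsto_0:
  "(\<lambda>n. 2 * (22 * exp (- 4)) ^ n + 2 * (real n)\<^sup>2 * exp (- (9 / 4 * sqrt n))) \<longlonglongrightarrow> 0"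
proof -
  \<comment> \<open>\<open>(3/2)^8\<close> is about 25.6, a rational lower bound for
    \<open>exp 4\<close> that exceeds 22.\<close>
  have "(3/2 :: real) ^ 8 \<le> exp (1/2) ^ 8"
    using exp_ge_add_one_self[of "1/2"] by (intro power_mono) auto
  also have "exp (1/2 :: real) ^ 8 = exp 4" by (simp add: exp_of_nat_mult[symmetric])
  finally have "22 < exp (4 :: real)" by (simp add: power_divide)
  then have "22 * exp (- 4 :: real) < 1" by (simp add: exp_minus field_simps)
  then have "(\<lambda>n. (22 * exp (- 4 :: real)) ^ n) \<longlonglongrightarrow> 0" by (intro LIMSEQ_realpow_zero) auto
  moreover have "(\<lambda>n. (real n)\<^sup>2 * exp (- (9 / 4 * sqrt n))) \<longlonglongrightarrow> 0" by real_asymp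
  ultimately have "(\<lambda>n. 2 * (22 * exp (- 4)) ^ n + 2 * ((real n)\<^sup>2 * exp (- (9 / 4 * sqrt n)))) \<longlonglongrightarrow> 2 * 0 + 2 * 0"
    by (intro tendsto_add tendsto_mult_left)
  then show ?thesis by (simp add: mult.assoc)
qed

text \<open>The failure bound depends on \<open>n\<close> alone, so one null sequence serves all
  \<open>k\<close>, \<open>s\<close> and partitions.\<close>

theorem theorem1:
  fixes p q c :: real
  assumes "0 \<le> q" and "q < p" and "p \<le> 1"
    and "c = max (88 / (p - q)) (72 / (p - q)\<^sup>2)"
  shows "\<exists>\<epsilon> :: nat \<Rightarrow> real. \<epsilon> \<longlonglongrightarrow> 0 \<and>
    (\<forall>\<^sub>F n in sequentially. \<forall>(k::nat) (s::nat) (\<C> :: nat set set).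
       n = k * s \<and> partition_on {1..n} \<C> \<and> card \<C> = k \<and> (\<forall>C\<in>\<C>. card C = s) \<and>
       real s \<ge> c * sqrt (real n) \<longrightarrow>
       measure_pmf.prob (planted_partition n \<C> p q)
         {E. {R. identify_clusters s {1..n} E R} = {\<C>}} \<ge> 1 - \<epsilon> n)"
proof (intro exI conjI)
  show "\<forall>\<^sub>F n in sequentially. \<forall>(k::nat) (s::nat) (\<C> :: nat set set).
       n = k * s \<and> partition_on {1..n} \<C> \<and> card \<C> = k \<and> (\<forall>C\<in>\<C>. card C = s) \<and>
       real s \<ge> c * sqrt (real n) \<longrightarrow>
       measure_pmf.prob (planted_partition n \<C> p q)
         {E. {R. identify_clusters s {1..n} E R} = {\<C>}}
       \<ge> 1 - (2 * (22 * exp (- 4)) ^ n + 2 * (real n)\<^sup>2 * exp (- (9 / 4 * sqrt n)))"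
    using eventually_gt_at_top[of 0]
  proof (eventually_elim, intro allI impI, elim conjE)
    fix n k s :: nat and \<C> :: "nat set set"
    assume n: "0 < n" "n = k * s" and part: "partition_on {1..n} \<C>" "card \<C> = k"
      and size: "\<forall>C\<in>\<C>. card C = s" and s: "c * sqrt n \<le> s"
    have "72 / (p - q)\<^sup>2 * sqrt n \<le> c * sqrt n" using assms(4) by (intro mult_right_mono) auto
    then have "72 / (p - q)\<^sup>2 * sqrt n \<le> s" using s by linarith
    then have "72 * sqrt n \<le> (p - q)\<^sup>2 * s" using assms(2) by (simp add: field_simps)
    moreover have "card \<C> \<le> n" using n part by simp
    ultimately show "measure_pmf.prob (planted_partition n \<C> p q)
         {E. {R. identify_clusters s {1..n} E R} = {\<C>}}
       \<ge> 1 - (2 * (22 * exp (- 4)) ^ n + 2 * (real n)\<^sup>2 * exp (- (9 / 4 * sqrt n)))"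
      using assms n part size by (intro recovery_prob) auto
  qed
qed (rule failure_tendsto_0)

end
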